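(* Let $W$ be a finite Coxeter group and let $x,y$ be nonzero real numbers. Then in the group algebra of $W$, $M_{W,x}\,M_{W,y}=M_{W,xy}$.
   Context: $W$ is a finite Coxeter group of rank $n$ acting on its $n$-dimensional real reflection representation $V$, with (reduced, $W$-stable) root system $\Phi$ and base $\Pi$ of simple roots. For $w\in W$, $Des(w)=\{\alpha\in\Pi : w(\alpha)\text{ is a negative root}\}$. For $J\subseteq\Pi$ let $X_J=\{w\in W: Des(w)\cap J=\emptyset\}$ and $x_J=\sum_{w\in X_J}w\in\mathbb{Q}[W]$. On subsets of $\Pi$ put $J\sim K$ iff $w(J)=K$ for some $w\in W$; $\lambda$ denotes an equivalence class, $\lambda(K)$ the class of $K$, $|\lambda|$ the number of subsets in $\lambda$, and $\|\lambda\|=|J|$ for any $J\in\lambda$. For $K\subseteq J\subseteq\Pi$ let $\mu_K^J=\frac{|\{w\in X_J: w(K)\subseteq\Pi\}|}{|\lambda(K)|}$, and $\mu_K^J=0$ if $K\not\subseteq J$. Let $(\beta_K^J)$ be the inverse of the matrix $(\mu_K^J)$ (rows indexed by $J$, columns by $K$). Define $e_\lambda=\frac{1}{|\lambda|}\sum_{J\in\lambda}\sum_{K\subseteq J}\beta_K^J x_K$. (It is known, by Bergeron–Bergeron–Howlett–Taylor, that the $e_\lambda$ are orthogonal idempotents of the group algebra summing to the identity.) For real $x\ne0$ define $M_{W,x}=\sum_\lambda \frac{e_\lambda}{x^{\|\lambda\|}}$ in the group algebra $\mathbb{R}[W]$. *)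

theory Defs
  imports "HOL-Analysis.Analysis"
begin

text \<open>
  A finite Coxeter group is realised as the finite real reflection group of a finite reduced root
  system \<open>\<Phi>\<close> in a Euclidean space, with base \<open>\<Delta>\<close> of simple roots. Roots need not be
  normalised and no crystallographic condition is imposed, so all finite types occur. The
  reflection representation is \<open>span \<Phi>\<close>. The ambient space may be larger (the group then fixes
  the orthogonal complement pointwise), which admits rank 0, because a type in class
  \<open>euclidean_space\<close> has dimension at least 1.
\<close>

definition reflection :: "'a::euclidean_space \<Rightarrow> 'a \<Rightarrow> 'a" where
  "reflection \<alpha> v = v - (2 * (v \<bullet> \<alpha>) / (\<alpha> \<bullet> \<alpha>)) *\<^sub>R \<alpha>"

definition root_system :: "'a::euclidean_space set \<Rightarrow> bool" where
  "root_system \<Phi> \<longleftrightarrow>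
     finite \<Phi> \<and> 0 \<notin> \<Phi> \<and>
     (\<forall>\<alpha>\<in>\<Phi>. reflection \<alpha> ` \<Phi> = \<Phi>) \<and>
     (\<forall>\<alpha>\<in>\<Phi>. \<forall>c. c *\<^sub>R \<alpha> \<in> \<Phi> \<longrightarrow> c = 1 \<or> c = -1)"

definition nonneg_comb :: "'a::euclidean_space set \<Rightarrow> 'a set" where
  "nonneg_comb \<Delta> = {v. \<exists>c. (\<forall>\<alpha>\<in>\<Delta>. c \<alpha> \<ge> 0) \<and> v = (\<Sum>\<alpha>\<in>\<Delta>. c \<alpha> *\<^sub>R \<alpha>)}"

definition root_base :: "'a::euclidean_space set \<Rightarrow> 'a set \<Rightarrow> bool" where
  "root_base \<Phi> \<Delta> \<longleftrightarrow>
     \<Delta> \<subseteq> \<Phi> \<and> independent \<Delta> \<and>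
     (\<forall>\<beta>\<in>\<Phi>. \<beta> \<in> nonneg_comb \<Delta> \<or> - \<beta> \<in> nonneg_comb \<Delta>)"

definition negative_roots :: "'a::euclidean_space set \<Rightarrow> 'a set \<Rightarrow> 'a set" where
  "negative_roots \<Phi> \<Delta> = {\<beta>\<in>\<Phi>. - \<beta> \<in> nonneg_comb \<Delta>}"

text \<open>Reflections are involutions, so closure under composition already yields a group.\<close>

inductive_set refl_group :: "('a::euclidean_space) set \<Rightarrow> ('a \<Rightarrow> 'a) set" for \<Phi> where
  one: "id \<in> refl_group \<Phi>"
| step: "\<alpha> \<in> \<Phi> \<Longrightarrow> w \<in> refl_group \<Phi> \<Longrightarrow> reflection \<alpha> \<circ> w \<in> refl_group \<Phi>"

text \<open>
  An element of the group algebra \<open>\<real>[W]\<close> of a finite group \<open>W\<close> of transformations is represented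
  by its coefficient function, taken to be 0 outside \<open>W\<close>. Its multiplication is convolution.
\<close>

definition galg_mult ::
    "('a \<Rightarrow> 'a) set \<Rightarrow> (('a \<Rightarrow> 'a) \<Rightarrow> real) \<Rightarrow> (('a \<Rightarrow> 'a) \<Rightarrow> real) \<Rightarrow> (('a \<Rightarrow> 'a) \<Rightarrow> real)" where
  "galg_mult W f g = (\<lambda>w. \<Sum>(u, v)\<in>{(u, v) \<in> W \<times> W. u \<circ> v = w}. f u * g v)"

definition Des :: "'a::euclidean_space set \<Rightarrow> 'a set \<Rightarrow> ('a \<Rightarrow> 'a) \<Rightarrow> 'a set" where
  "Des \<Phi> \<Delta> w = {\<alpha>\<in>\<Delta>. w \<alpha> \<in> negative_roots \<Phi> \<Delta>}"

definition X_set :: "'a::euclidean_space set \<Rightarrow> 'a set \<Rightarrow> 'a set \<Rightarrow> ('a \<Rightarrow> 'a) set" where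
  "X_set \<Phi> \<Delta> J = {w \<in> refl_group \<Phi>. Des \<Phi> \<Delta> w \<inter> J = {}}"

definition x_elt :: "'a::euclidean_space set \<Rightarrow> 'a set \<Rightarrow> 'a set \<Rightarrow> ('a \<Rightarrow> 'a) \<Rightarrow> real" where
  "x_elt \<Phi> \<Delta> J = (\<lambda>w. if w \<in> X_set \<Phi> \<Delta> J then 1 else 0)"

definition subset_rel :: "'a::euclidean_space set \<Rightarrow> 'a set \<Rightarrow> ('a set \<times> 'a set) set" where
  "subset_rel \<Phi> \<Delta> = {(J, K). J \<subseteq> \<Delta> \<and> K \<subseteq> \<Delta> \<and> (\<exists>w\<in>refl_group \<Phi>. w ` J = K)}"

definition classes :: "'a::euclidean_space set \<Rightarrow> 'a set \<Rightarrow> 'a set set set" where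
  "classes \<Phi> \<Delta> = Pow \<Delta> // subset_rel \<Phi> \<Delta>"

definition class_of :: "'a::euclidean_space set \<Rightarrow> 'a set \<Rightarrow> 'a set \<Rightarrow> 'a set set" where
  "class_of \<Phi> \<Delta> K = subset_rel \<Phi> \<Delta> `` {K}"

text \<open>All members of a class have the same cardinality, so the choice is immaterial.\<close>

definition class_rank :: "'a set set \<Rightarrow> nat" where
  "class_rank C = card (SOME J. J \<in> C)"

text \<open>\<open>mu \<Phi> \<Delta> J K\<close> is \<open>\<mu>\<close> with superscript \<open>J\<close> (row) and subscript \<open>K\<close> (column); likewise for
  \<open>beta\<close> below.\<close>

definition mu :: "'a::euclidean_space set \<Rightarrow> 'a set \<Rightarrow> 'a set \<Rightarrow> 'a set \<Rightarrow> real" where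
  "mu \<Phi> \<Delta> J K =
     (if K \<subseteq> J
      then real (card {w \<in> X_set \<Phi> \<Delta> J. w ` K \<subseteq> \<Delta>}) / real (card (class_of \<Phi> \<Delta> K))
      else 0)"

text \<open>The two-sided inverse of a square matrix with rows and columns indexed by the set \<open>I\<close>; the
  entries outside \<open>I\<close> are fixed to be 0 to make it unique.\<close>

definition matrix_inv_on :: "'i set \<Rightarrow> ('i \<Rightarrow> 'i \<Rightarrow> real) \<Rightarrow> 'i \<Rightarrow> 'i \<Rightarrow> real" where
  "matrix_inv_on I A = (THE B.
     (\<forall>i\<in>I. \<forall>k\<in>I. (\<Sum>j\<in>I. A i j * B j k) = (if i = k then 1 else 0)) \<and>
     (\<forall>i\<in>I. \<forall>k\<in>I. (\<Sum>j\<in>I. B i j * A j k) = (if i = k then 1 else 0)) \<and>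
     (\<forall>i k. i \<notin> I \<or> k \<notin> I \<longrightarrow> B i k = 0))"

definition beta :: "'a::euclidean_space set \<Rightarrow> 'a set \<Rightarrow> 'a set \<Rightarrow> 'a set \<Rightarrow> real" where
  "beta \<Phi> \<Delta> = matrix_inv_on (Pow \<Delta>) (mu \<Phi> \<Delta>)"

definition e_elt :: "'a::euclidean_space set \<Rightarrow> 'a set \<Rightarrow> 'a set set \<Rightarrow> ('a \<Rightarrow> 'a) \<Rightarrow> real" where
  "e_elt \<Phi> \<Delta> C =
     (\<lambda>w. 1 / real (card C) * (\<Sum>J\<in>C. \<Sum>K\<in>Pow J. beta \<Phi> \<Delta> J K * x_elt \<Phi> \<Delta> K w))"

definition M_elt :: "'a::euclidean_space set \<Rightarrow> 'a set \<Rightarrow> real \<Rightarrow> ('a \<Rightarrow> 'a) \<Rightarrow> real" where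
  "M_elt \<Phi> \<Delta> x = (\<lambda>w. \<Sum>C\<in>classes \<Phi> \<Delta>. e_elt \<Phi> \<Delta> C w / x ^ class_rank C)"

end

(*
  Identify W with the chambers of its reflection arrangement. The faces, written as sign vectors on
  the roots, form a monoid (Tits product) with F + F = F and F + G + F = F + G, and the sum of all
  faces of type J acts on chambers as x_J does on W; this turns products in the face algebra into
  products in the group algebra in reverse order, which is harmless because M_x M_y is symmetric
  in x and y.

  In the face algebra let u_X be the average of the faces whose set of vanishing roots is X. The
  recursion E_X = u_X (1 - sum of E_Y over Y strictly inside X) yields orthogonal idempotents
  (Saliola). Every face F satisfies F E_X = 0 unless X is contained in its zero set, so F is the sum
  of the F E_Y over the remaining Y. Adding this up over the faces F of type J, the coefficients that
  appear are the numbers of w in X_J with w(K) inside the base, that is, the matrix mu. Inverting mu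
  identifies M_x with the sum of the x^(- dim span X) E_X, and these elements visibly multiply as
  claimed.
*)
theory Submission
  imports Defs "HOL-Library.Poly_Mapping" "HOL-Library.Function_Algebras"
begin

section \<open>Idempotents in the algebra of a left regular band\<close>

text \<open>The numbers \<open>beta\<close> are known only as entries of an inverse matrix, so
  products of the \<open>e_elt\<close> cannot be computed from a formula. The proof therefore
  expands the explicit side, the sum of all faces of one type, and inverts that expansion only at
  the end. A single face \<open>F\<close> is in general no combination of the idempotents
  \<open>E_X\<close>, since \<open>F E_Y\<close> need not be a multiple of \<open>E_Y\<close>. The
  pieces \<open>pidem G\<close>, that is \<open>G E_Y\<close> for a face \<open>G\<close> with
  support \<open>Y\<close>, repair this: \<open>F E_Y\<close> is an average of the pieces of the
  faces \<open>F + G\<close>, and \<open>E_Y\<close> is the average of the pieces of its own faces.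
  Averaging uniformly over all faces with a given support, instead of choosing one of them, makes
  the coefficients constant on \<open>W\<close>-orbits of faces, so that a matrix indexed by types
  can record them. The class sizes in the denominators of \<open>mu\<close> and of
  \<open>e_elt\<close> cancel against each other. The weight attached to a class depends only on a
  support, because \<open>J\<close> is a basis of the span of the zero set of its standard
  face.\<close>

lemma poly_mapping_eq_sum_single:
  "a = (\<Sum>k\<in>Poly_Mapping.keys a. Poly_Mapping.single k (Poly_Mapping.lookup a k))"
  by (rule poly_mapping_eqI)
    (simp add: lookup_sum lookup_single when_def in_keys_iff sum.delta' if_distrib cong: if_cong)

text \<open>The monoid is not commutative, but its neutral element commutes with every monomial and
  the coefficients commute. This lets scalars move freely through products.\<close>

lemma single_zero_commute:
  fixes a :: "'s::monoid_add \<Rightarrow>\<^sub>0 real"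
  shows "a * Poly_Mapping.single 0 c = Poly_Mapping.single 0 c * a"
proof -
  have "(\<Sum>k\<in>Poly_Mapping.keys a. Poly_Mapping.single k (Poly_Mapping.lookup a k)) * Poly_Mapping.single 0 c =
    Poly_Mapping.single 0 c * (\<Sum>k\<in>Poly_Mapping.keys a. Poly_Mapping.single k (Poly_Mapping.lookup a k))"
    by (simp add: sum_distrib_left sum_distrib_right mult_single mult.commute)
  then show ?thesis
    by (simp only: poly_mapping_eq_sum_single[of a, symmetric])
qed

abbreviation scalar :: "real \<Rightarrow> 's::monoid_add \<Rightarrow>\<^sub>0 real" where
  "scalar c \<equiv> Poly_Mapping.single 0 c"

abbreviation point :: "'s::monoid_add \<Rightarrow> 's \<Rightarrow>\<^sub>0 real" where
  "point F \<equiv> Poly_Mapping.single F 1"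

lemma scalar_mult_left_commute:
  fixes a :: "'s::monoid_add \<Rightarrow>\<^sub>0 real"
  shows "a * (scalar c * b) = scalar c * (a * b)"
  by (metis mult.assoc single_zero_commute)

lemma scalar_scalar:
  fixes a :: "'s::monoid_add \<Rightarrow>\<^sub>0 real"
  shows "scalar c * (scalar d * a) = scalar (c * d) * a"
  by (simp add: mult.assoc[symmetric] mult_single)

lemma scalar_sum: "finite A \<Longrightarrow> scalar (\<Sum>i\<in>A. f i) = (\<Sum>i\<in>A. scalar (f i))"
  by (induction A rule: finite_induct) (auto simp: single_add)

lemma sum_scalar_card:
  fixes a :: "'s::monoid_add \<Rightarrow>\<^sub>0 real"
  shows "(\<Sum>i\<in>A. a) = scalar (real (card A)) * a"
  by simp

text \<open>Here \<open>z\<close> is the set on which an element vanishes, so a smaller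
  \<open>z\<close> means a more generic element. The identities \<open>F + F = F\<close> and
  \<open>F + G + F = F + G\<close> both follow from \<open>absorb\<close>, the second because
  \<open>z (F + G)\<close> is contained in \<open>z F\<close> by \<open>z_add\<close>.\<close>

locale left_regular_band =
  fixes S :: "'s::monoid_add set" and z :: "'s \<Rightarrow> 'b set"
  assumes finite_S: "finite S"
    and add_closed: "F \<in> S \<Longrightarrow> G \<in> S \<Longrightarrow> F + G \<in> S"
    and z_add: "F \<in> S \<Longrightarrow> G \<in> S \<Longrightarrow> z (F + G) = z F \<inter> z G"
    and absorb: "F \<in> S \<Longrightarrow> G \<in> S \<Longrightarrow> z F \<subseteq> z G \<Longrightarrow> F + G = F"
begin

definition fiber :: "'b set \<Rightarrow> 's set" where
  "fiber X = {G \<in> S. z G = X}"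

definition fiber_card :: "'b set \<Rightarrow> real" where
  "fiber_card X = real (card (fiber X))"

definition avg :: "'b set \<Rightarrow> 's \<Rightarrow>\<^sub>0 real" where
  "avg X = scalar (1 / fiber_card X) * (\<Sum>G\<in>fiber X. point G)"

function idem :: "'b set \<Rightarrow> 's \<Rightarrow>\<^sub>0 real" where
  "idem X = avg X * (1 - (\<Sum>Y\<in>{Y \<in> z ` S. Y \<subset> X}. idem Y))"
  by auto
termination
  by (relation "Wellfounded.measure (\<lambda>X. card {Y \<in> z ` S. Y \<subset> X})")
    (auto intro!: psubset_card_mono simp: finite_S)

declare idem.simps [simp del]

lemma finite_fiber [simp]: "finite (fiber X)"
  by (simp add: fiber_def finite_S)

lemma fiber_card_pos: "X \<in> z ` S \<Longrightarrow> fiber_card X > 0"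
  using finite_fiber[of X] by (auto simp: fiber_card_def card_gt_0_iff fiber_def simp del: finite_fiber)

lemma finite_supports [simp]: "finite (z ` S)"
  by (simp add: finite_S)

lemma point_mult_avg:
  assumes "F \<in> S"
  shows "point F * avg X = scalar (1 / fiber_card X) * (\<Sum>G\<in>fiber X. point (F + G))"
  by (simp add: avg_def scalar_mult_left_commute sum_distrib_left mult_single)

lemma scalar_avg:
  fixes a :: "'s \<Rightarrow>\<^sub>0 real"
  assumes "X \<in> z ` S"
  shows "scalar (1 / fiber_card X) * (\<Sum>G\<in>fiber X. a) = a"
  using fiber_card_pos[OF assms]
  by (simp only: sum_scalar_card scalar_scalar fiber_card_def) (simp add: card_gt_0_iff)

lemma point_mult_avg_absorb:
  assumes "F \<in> S" "X \<in> z ` S" "z F \<subseteq> X"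
  shows "point F * avg X = point F"
proof -
  have "(\<Sum>G\<in>fiber X. point (F + G)) = (\<Sum>G\<in>fiber X. point F)"
    using assms absorb by (intro sum.cong) (auto simp: fiber_def)
  then show ?thesis
    using assms by (simp only: point_mult_avg scalar_avg)
qed

lemma avg_mult_self:
  assumes "X \<in> z ` S"
  shows "avg X * avg X = avg X"
proof -
  have "(\<Sum>G\<in>fiber X. point G) * avg X = (\<Sum>G\<in>fiber X. point G)"
    unfolding sum_distrib_right using assms
    by (intro sum.cong) (auto simp: fiber_def point_mult_avg_absorb)
  moreover have "avg X * avg X = scalar (1 / fiber_card X) * ((\<Sum>G\<in>fiber X. point G) * avg X)"
    by (subst (1) avg_def) (simp only: mult.assoc)
  ultimately show ?thesis
    by (simp add: avg_def)
qed

text \<open>The recursion for \<open>idem\<close> is made for this: \<open>F\<close> absorbs the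
  average over its own support, so \<open>F\<close> times \<open>idem (z F)\<close> is what the
  smaller supports leave over from \<open>F\<close>.\<close>

lemma sum_point_mult_idem:
  assumes "F \<in> S"
  shows "(\<Sum>Y\<in>{Y \<in> z ` S. Y \<subseteq> z F}. point F * idem Y) = point F"
proof -
  have eq: "{Y \<in> z ` S. Y \<subseteq> z F} = insert (z F) {Y \<in> z ` S. Y \<subset> z F}"
    using assms by auto
  have "point F * idem (z F) =
      point F - (\<Sum>Y\<in>{Y \<in> z ` S. Y \<subset> z F}. point F * idem Y)"
    using assms
    by (subst idem.simps) (simp add: mult.assoc[symmetric] point_mult_avg_absorb right_diff_distrib
        sum_distrib_left)
  then show ?thesis
    by (simp add: eq)
qed

text \<open>Each \<open>F + G\<close> with \<open>z G = X\<close> has a support strictly inside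
  \<open>X\<close>. On it the idempotents of supports below \<open>z (F + G)\<close> already add up
  to 1, and the remaining ones below \<open>X\<close> vanish by induction. Hence the second factor
  in the recursion for \<open>idem X\<close> annihilates \<open>F + G\<close>.\<close>

lemma point_mult_idem_eq_0:
  assumes "F \<in> S" "X \<in> z ` S" "\<not> X \<subseteq> z F"
  shows "point F * idem X = 0"
  using assms
proof (induction "card {Y \<in> z ` S. Y \<subset> X}" arbitrary: X F rule: less_induct)
  case less
  have IH: "point H * idem Y = 0" if "H \<in> S" "Y \<in> z ` S" "Y \<subset> X" "\<not> Y \<subseteq> z H" for Y H
    using that by (intro less.hyps psubset_card_mono) (auto simp: finite_S)
  have *: "point (F + G) * (1 - (\<Sum>Y\<in>{Y \<in> z ` S. Y \<subset> X}. idem Y)) = 0" if "G \<in> fiber X" for G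
  proof -
    have H: "F + G \<in> S" "z (F + G) \<subset> X"
      using that less.prems z_add add_closed by (auto simp: fiber_def)
    have "(\<Sum>Y\<in>{Y \<in> z ` S. Y \<subset> X}. point (F + G) * idem Y) =
       (\<Sum>Y\<in>{Y \<in> z ` S. Y \<subseteq> z (F + G)}. point (F + G) * idem Y)"
      using H by (intro sum.mono_neutral_right) (auto intro!: IH simp: finite_S)
    then show ?thesis
      using sum_point_mult_idem[OF H(1)] by (simp add: right_diff_distrib sum_distrib_left)
  qed
  have "point F * idem X = scalar (1 / fiber_card X) *
      (\<Sum>G\<in>fiber X. point (F + G) * (1 - (\<Sum>Y\<in>{Y \<in> z ` S. Y \<subset> X}. idem Y)))"
    unfolding sum_distrib_right[symmetric] mult.assoc[symmetric] point_mult_avg[OF less.prems(1), symmetric]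
    by (subst idem.simps) (simp only: mult.assoc)
  also have "\<dots> = 0"
    using * by simp
  finally show ?case .
qed

lemma avg_mult_idem_self:
  assumes "X \<in> z ` S"
  shows "avg X * idem X = idem X"
  by (subst (1 2) idem.simps) (simp add: mult.assoc[symmetric] avg_mult_self[OF assms])

text \<open>Off-diagonal products \<open>X * Y\<close> with \<open>Y\<close> below \<open>X\<close> vanish by the recursion, the others because every
  face in the average over \<open>X\<close> annihilates the idempotent of \<open>Y\<close>.\<close>

lemma idem_orthogonal:
  assumes "X \<in> z ` S" "Y \<in> z ` S"
  shows "idem X * idem Y = (if X = Y then idem X else 0)"
  using assms
proof (induction "card {Y \<in> z ` S. Y \<subset> X}" arbitrary: X rule: less_induct)
  case less
  have IH: "idem Y' * idem Y = (if Y' = Y then idem Y' else 0)" if "Y' \<in> z ` S" "Y' \<subset> X" for Y'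
    using that less.prems by (intro less.hyps psubset_card_mono) (auto simp: finite_S)
  have eq: "idem X * idem Y = avg X * (idem Y - (\<Sum>Y'\<in>{Y \<in> z ` S. Y \<subset> X}. idem Y' * idem Y))"
    by (subst (1) idem.simps) (simp add: mult.assoc left_diff_distrib sum_distrib_right)
  have "(\<Sum>Y'\<in>{Y \<in> z ` S. Y \<subset> X}. idem Y' * idem Y) =
      (\<Sum>Y'\<in>{Y \<in> z ` S. Y \<subset> X}. if Y' = Y then idem Y' else 0)"
    using IH by (intro sum.cong) auto
  also have "\<dots> = (if Y \<subset> X then idem Y else 0)"
    using less.prems by (simp add: sum.delta' finite_S)
  finally have eq': "idem X * idem Y = (if Y \<subset> X then 0 else avg X * idem Y)"
    using eq by simp
  consider "Y = X" | "Y \<subset> X" | "\<not> Y \<subseteq> X" by blast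
  then show ?case
  proof cases
    case 1
    then show ?thesis using eq' avg_mult_idem_self less.prems by simp
  next
    case 2
    then show ?thesis using eq' by auto
  next
    case 3
    have "(\<Sum>G\<in>fiber X. point G * idem Y) = 0"
      using 3 less.prems by (intro sum.neutral) (auto simp: fiber_def intro!: point_mult_idem_eq_0)
    then have "avg X * idem Y = 0"
      by (simp add: avg_def mult.assoc sum_distrib_right)
    then show ?thesis using eq' 3 by auto
  qed
qed

definition diag :: "('b set \<Rightarrow> real) \<Rightarrow> 's \<Rightarrow>\<^sub>0 real" where
  "diag t = (\<Sum>X\<in>z ` S. scalar (t X) * idem X)"

lemma diag_mult: "diag s * diag t = diag (\<lambda>X. s X * t X)"
proof -
  have "diag s * diag t =
      (\<Sum>X\<in>z ` S. \<Sum>Y\<in>z ` S. scalar (s X) * idem X * (scalar (t Y) * idem Y))"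
    by (simp add: diag_def sum_product)
  also have "\<dots> = (\<Sum>X\<in>z ` S. \<Sum>Y\<in>z ` S. if X = Y then scalar (s X * t X) * idem X else 0)"
    by (intro sum.cong refl)
      (auto simp: mult.assoc scalar_mult_left_commute[of "idem _"] scalar_scalar idem_orthogonal)
  also have "\<dots> = diag (\<lambda>X. s X * t X)"
    by (simp add: diag_def finite_S)
  finally show ?thesis .
qed

section \<open>Faces and diagonal elements as combinations of localized idempotents\<close>

definition pidem :: "'s \<Rightarrow> 's \<Rightarrow>\<^sub>0 real" where
  "pidem G = point G * idem (z G)"

lemma idem_eq_sum_pidem:
  assumes "X \<in> z ` S"
  shows "idem X = scalar (1 / fiber_card X) * (\<Sum>G\<in>fiber X. pidem G)"
proof -
  have "(\<Sum>G\<in>fiber X. pidem G) = (\<Sum>G\<in>fiber X. point G) * idem X"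
    unfolding sum_distrib_right by (intro sum.cong) (auto simp: pidem_def fiber_def)
  then show ?thesis
    using avg_mult_idem_self[OF assms] by (simp add: avg_def mult.assoc)
qed

lemma diag_eq_sum_pidem:
  "diag t = (\<Sum>G\<in>S. scalar (t (z G) / fiber_card (z G)) * pidem G)"
proof -
  have "diag t = (\<Sum>X\<in>z ` S. \<Sum>G\<in>fiber X. scalar (t (z G) / fiber_card (z G)) * pidem G)"
    unfolding diag_def
  proof (intro sum.cong refl)
    fix X assume X: "X \<in> z ` S"
    have "scalar (t X) * idem X = (\<Sum>G\<in>fiber X. scalar (t X / fiber_card X) * pidem G)"
      by (simp add: idem_eq_sum_pidem[OF X] scalar_scalar sum_distrib_left[symmetric])
    also have "\<dots> = (\<Sum>G\<in>fiber X. scalar (t (z G) / fiber_card (z G)) * pidem G)"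
      by (intro sum.cong) (auto simp: fiber_def)
    finally show "scalar (t X) * idem X =
      (\<Sum>G\<in>fiber X. scalar (t (z G) / fiber_card (z G)) * pidem G)" .
  qed
  also have "\<dots> = (\<Sum>G\<in>S. scalar (t (z G) / fiber_card (z G)) * pidem G)"
    unfolding fiber_def by (rule sum.image_gen[symmetric]) (rule finite_S)
  finally show ?thesis .
qed

text \<open>Insert \<open>avg Y\<close> before each \<open>idem Y\<close>, which it fixes from the
  left, and multiply the average by \<open>F\<close>. As \<open>z G\<close> lies in
  \<open>z F\<close>, the face \<open>F + G\<close> has the same support as \<open>G\<close>, so
  \<open>F + G\<close> times \<open>idem Y\<close> is a piece \<open>pidem (F + G)\<close>.\<close>

lemma point_eq_sum_pidem:
  assumes "F \<in> S"
  shows "point F =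
    (\<Sum>G\<in>{G \<in> S. z G \<subseteq> z F}. scalar (1 / fiber_card (z G)) * pidem (F + G))"
proof -
  have "point F = (\<Sum>Y\<in>{Y \<in> z ` S. Y \<subseteq> z F}. point F * avg Y * idem Y)"
    using sum_point_mult_idem[OF assms] avg_mult_idem_self by (simp add: mult.assoc)
  also have "\<dots> = (\<Sum>Y\<in>{Y \<in> z ` S. Y \<subseteq> z F}. \<Sum>G\<in>fiber Y.
      scalar (1 / fiber_card (z G)) * pidem (F + G))"
  proof (intro sum.cong refl)
    fix Y assume Y: "Y \<in> {Y \<in> z ` S. Y \<subseteq> z F}"
    have "(\<Sum>G\<in>fiber Y. scalar (1 / fiber_card Y) * (point (F + G) * idem Y)) =
      (\<Sum>G\<in>fiber Y. scalar (1 / fiber_card (z G)) * pidem (F + G))"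
    proof (intro sum.cong refl)
      fix G assume "G \<in> fiber Y"
      then have "z G = Y" "z (F + G) = Y"
        using Y assms z_add by (auto simp: fiber_def)
      then show "scalar (1 / fiber_card Y) * (point (F + G) * idem Y) =
        scalar (1 / fiber_card (z G)) * pidem (F + G)"
        by (simp add: pidem_def)
    qed
    then show "point F * avg Y * idem Y =
        (\<Sum>G\<in>fiber Y. scalar (1 / fiber_card (z G)) * pidem (F + G))"
      by (simp add: point_mult_avg assms mult.assoc sum_distrib_right sum_distrib_left)
  qed
  also have "{Y \<in> z ` S. Y \<subseteq> z F} = z ` {G \<in> S. z G \<subseteq> z F}"
    by auto
  also have "(\<Sum>Y\<in>z ` {G \<in> S. z G \<subseteq> z F}. \<Sum>G\<in>fiber Y.
      scalar (1 / fiber_card (z G)) * pidem (F + G)) =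
      (\<Sum>Y\<in>z ` {G \<in> S. z G \<subseteq> z F}. \<Sum>G\<in>{G \<in> {G \<in> S. z G \<subseteq> z F}. z G = Y}.
      scalar (1 / fiber_card (z G)) * pidem (F + G))"
    by (intro sum.cong) (auto simp: fiber_def)
  also have "\<dots> = (\<Sum>G\<in>{G \<in> S. z G \<subseteq> z F}. scalar (1 / fiber_card (z G)) * pidem (F + G))"
    by (rule sum.image_gen[symmetric]) (simp add: finite_S)
  finally show ?thesis .
qed

text \<open>Collecting equal faces \<open>F + G = H\<close> works because \<open>z G = z H\<close>
  for all pairs that occur: the weight depends on \<open>H\<close> alone, and only the number of
  pairs remains.\<close>

lemma sum_point_eq_sum_pidem:
  assumes "T \<subseteq> S"
  shows "(\<Sum>F\<in>T. point F) = (\<Sum>H\<in>S.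
    scalar (real (card {(F, G). F \<in> T \<and> G \<in> S \<and> z G \<subseteq> z F \<and> F + G = H}) / fiber_card (z H)) * pidem H)"
proof -
  let ?P = "{(F, G). F \<in> T \<and> G \<in> S \<and> z G \<subseteq> z F}"
  let ?g = "\<lambda>H. scalar (1 / fiber_card (z H)) * pidem H"
  have finP: "finite ?P"
    by (rule finite_subset[of _ "S \<times> S"]) (use assms finite_S in auto)
  have "(\<Sum>F\<in>T. point F) =
    (\<Sum>F\<in>T. \<Sum>G\<in>{G \<in> S. z G \<subseteq> z F}. scalar (1 / fiber_card (z G)) * pidem (F + G))"
    using assms by (intro sum.cong refl point_eq_sum_pidem) auto
  also have "\<dots> = (\<Sum>(F, G)\<in>?P. scalar (1 / fiber_card (z G)) * pidem (F + G))"
  proof (subst sum.Sigma)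
    show "finite T" using assms finite_S finite_subset by blast
    show "\<forall>F\<in>T. finite {G \<in> S. z G \<subseteq> z F}" using finite_S by simp
    have "(SIGMA F:T. {G \<in> S. z G \<subseteq> z F}) = ?P" by auto
    then show "(\<Sum>(F, G)\<in>(SIGMA F:T. {G \<in> S. z G \<subseteq> z F}). scalar (1 / fiber_card (z G)) * pidem (F + G))
      = (\<Sum>(F, G)\<in>?P. scalar (1 / fiber_card (z G)) * pidem (F + G))" by simp
  qed
  also have "\<dots> = (\<Sum>p\<in>?P. ?g (fst p + snd p))"
  proof (intro sum.cong refl)
    fix p assume p: "p \<in> ?P"
    obtain F G where "p = (F, G)" by (cases p)
    with p have "p = (F, G)" "F \<in> S" "G \<in> S" "z G \<subseteq> z F" using assms by auto
    moreover from this have "z (F + G) = z G" using z_add by auto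
    ultimately show "(case p of (F, G) \<Rightarrow> scalar (1 / fiber_card (z G)) * pidem (F + G)) = ?g (fst p + snd p)"
      by simp
  qed
  also have "\<dots> = (\<Sum>H\<in>S. \<Sum>p\<in>{p \<in> ?P. fst p + snd p = H}. ?g (fst p + snd p))"
    by (rule sum.group[symmetric]) (use finP finite_S add_closed assms in auto)
  also have "\<dots> = (\<Sum>H\<in>S. scalar (real (card {(F, G). F \<in> T \<and> G \<in> S \<and> z G \<subseteq> z F \<and> F + G = H})
      / fiber_card (z H)) * pidem H)"
  proof (intro sum.cong refl)
    fix H
    have eq: "{p \<in> ?P. fst p + snd p = H} = {(F, G). F \<in> T \<and> G \<in> S \<and> z G \<subseteq> z F \<and> F + G = H}"
      by auto
    have "(\<Sum>p\<in>{p \<in> ?P. fst p + snd p = H}. ?g (fst p + snd p)) =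
      (\<Sum>p\<in>{p \<in> ?P. fst p + snd p = H}. ?g H)"
      by (intro sum.cong) auto
    then show "(\<Sum>p\<in>{p \<in> ?P. fst p + snd p = H}. ?g (fst p + snd p)) =
      scalar (real (card {(F, G). F \<in> T \<and> G \<in> S \<and> z G \<subseteq> z F \<and> F + G = H}) / fiber_card (z H)) * pidem H"
      unfolding eq by (simp only: sum_scalar_card scalar_scalar) simp
  qed
  finally show ?thesis .
qed

end

section \<open>Inverting triangular matrices indexed by subsets\<close>

lemma matrix_mult_on_assoc:
  fixes A B C :: "'i \<Rightarrow> 'i \<Rightarrow> real"
  shows "(\<Sum>j\<in>I. (\<Sum>k\<in>I. A i k * B k j) * C j l) = (\<Sum>k\<in>I. A i k * (\<Sum>j\<in>I. B k j * C j l))"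
  unfolding sum_distrib_left sum_distrib_right mult.assoc by (rule sum.swap)

text \<open>Both sides equal the entry of the triple product \<open>A B C\<close>. It serves for the
  uniqueness of inverses and for turning a right inverse into a two-sided one.\<close>

lemma matrix_inverses_on_eq:
  fixes A B C :: "'i \<Rightarrow> 'i \<Rightarrow> real"
  assumes "finite I"
    and AB: "\<And>i k. i \<in> I \<Longrightarrow> k \<in> I \<Longrightarrow> (\<Sum>j\<in>I. A i j * B j k) = (if i = k then 1 else 0)"
    and BC: "\<And>i k. i \<in> I \<Longrightarrow> k \<in> I \<Longrightarrow> (\<Sum>j\<in>I. B i j * C j k) = (if i = k then 1 else 0)"
    and "i \<in> I" "k \<in> I"
  shows "A i k = C i k"
proof -
  have "(\<Sum>j\<in>I. (\<Sum>l\<in>I. A i l * B l j) * C j k) = (\<Sum>j\<in>I. if i = j then C j k else 0)"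
    using assms by (intro sum.cong) auto
  moreover have "(\<Sum>l\<in>I. A i l * (\<Sum>j\<in>I. B l j * C j k)) = (\<Sum>l\<in>I. if l = k then A i l else 0)"
    using assms by (intro sum.cong) auto
  ultimately show ?thesis
    using matrix_mult_on_assoc[where A=A and B=B and C=C and I=I and i=i and l=k] assms by simp
qed

lemma matrix_inv_on_eqI:
  fixes A B :: "'i \<Rightarrow> 'i \<Rightarrow> real"
  assumes "finite I"
    and AB: "\<And>i k. i \<in> I \<Longrightarrow> k \<in> I \<Longrightarrow> (\<Sum>j\<in>I. A i j * B j k) = (if i = k then 1 else 0)"
    and BA: "\<And>i k. i \<in> I \<Longrightarrow> k \<in> I \<Longrightarrow> (\<Sum>j\<in>I. B i j * A j k) = (if i = k then 1 else 0)"
    and out: "\<And>i k. i \<notin> I \<or> k \<notin> I \<Longrightarrow> B i k = 0"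
  shows "matrix_inv_on I A = B"
  unfolding matrix_inv_on_def
proof (rule the_equality)
  fix B' assume B': "(\<forall>i\<in>I. \<forall>k\<in>I. (\<Sum>j\<in>I. A i j * B' j k) = (if i = k then 1 else 0)) \<and>
     (\<forall>i\<in>I. \<forall>k\<in>I. (\<Sum>j\<in>I. B' i j * A j k) = (if i = k then 1 else 0)) \<and>
     (\<forall>i k. i \<notin> I \<or> k \<notin> I \<longrightarrow> B' i k = 0)"
  show "B' = B"
  proof (intro ext)
    fix i k
    show "B' i k = B i k"
      using B' out matrix_inverses_on_eq[of I B' A B i k] assms(1) AB by (cases "i \<in> I \<and> k \<in> I") auto
  qed
qed (use assms in auto)

text \<open>Forward substitution for the equation \<open>A B = 1\<close>. The test
  \<open>finite J\<close> inside the index set makes the recursion terminate on arbitrary sets: for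
  infinite \<open>J\<close> the sum is empty.\<close>

function tri_inv :: "('i set \<Rightarrow> 'i set \<Rightarrow> real) \<Rightarrow> 'i set \<Rightarrow> 'i set \<Rightarrow> real" where
  "tri_inv A J L =
    ((if J = L then 1 else 0) - (\<Sum>K\<in>{K. K \<subset> J \<and> finite J}. A J K * tri_inv A K L)) / A J J"
  by auto
termination
  by (relation "Wellfounded.measure (\<lambda>(A, J, L). card J)") (auto intro: psubset_card_mono)

declare tri_inv.simps [simp del]

lemma tri_inv_triangular: "finite J \<Longrightarrow> \<not> L \<subseteq> J \<Longrightarrow> tri_inv A J L = 0"
proof (induction J rule: finite_psubset_induct)
  case (psubset J)
  have "(\<Sum>K\<in>{K. K \<subset> J \<and> finite J}. A J K * tri_inv A K L) = 0"
    using psubset by (intro sum.neutral) auto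
  then show ?case using psubset.prems by (subst tri_inv.simps) auto
qed

lemma tri_inv_diag: "finite J \<Longrightarrow> tri_inv A J J = 1 / A J J"
proof -
  assume "finite J"
  then have "(\<Sum>K\<in>{K. K \<subset> J \<and> finite J}. A J K * tri_inv A K J) = 0"
    by (intro sum.neutral) (auto intro!: tri_inv_triangular intro: finite_subset)
  then show ?thesis by (subst tri_inv.simps) auto
qed

lemma tri_inv_right:
  assumes D: "finite D" and tri: "\<And>J K. J \<subseteq> D \<Longrightarrow> \<not> K \<subseteq> J \<Longrightarrow> A J K = 0"
    and diag: "\<And>J. J \<subseteq> D \<Longrightarrow> A J J \<noteq> 0" and J: "J \<subseteq> D"
  shows "(\<Sum>K\<in>Pow D. A J K * tri_inv A K L) = (if J = L then 1 else 0)"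
proof -
  have fJ: "finite J" using D J finite_subset by blast
  have "(\<Sum>K\<in>Pow D. A J K * tri_inv A K L) = (\<Sum>K\<in>insert J {K. K \<subset> J}. A J K * tri_inv A K L)"
    using D J tri[OF J] by (intro sum.mono_neutral_right) auto
  also have "\<dots> = A J J * tri_inv A J L + (\<Sum>K\<in>{K. K \<subset> J}. A J K * tri_inv A K L)"
    using fJ by (intro sum.insert) (auto intro: finite_subset[of _ "Pow J"])
  also have "A J J * tri_inv A J L =
      (if J = L then 1 else 0) - (\<Sum>K\<in>{K. K \<subset> J}. A J K * tri_inv A K L)"
    using diag[OF J] fJ by (subst tri_inv.simps) simp
  finally show ?thesis by simp
qed

text \<open>Forward substitution yields only a right inverse \<open>B\<close> of \<open>A\<close>.
  But \<open>B\<close> is again triangular with nonzero diagonal, so it has a right inverse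
  \<open>C\<close> of its own. Then \<open>A = A (B C) = (A B) C = C\<close>, and
  \<open>B A = 1\<close> follows.\<close>

lemma triangular_matrix_inv_on:
  fixes A :: "'i set \<Rightarrow> 'i set \<Rightarrow> real"
  assumes D: "finite D" and tri: "\<And>J K. J \<subseteq> D \<Longrightarrow> \<not> K \<subseteq> J \<Longrightarrow> A J K = 0"
    and diag: "\<And>J. J \<subseteq> D \<Longrightarrow> A J J \<noteq> 0"
  shows "\<And>J L. J \<subseteq> D \<Longrightarrow> L \<subseteq> D \<Longrightarrow>
      (\<Sum>K\<in>Pow D. matrix_inv_on (Pow D) A J K * A K L) = (if J = L then 1 else 0)"
    and "\<And>J K. J \<subseteq> D \<Longrightarrow> \<not> K \<subseteq> J \<Longrightarrow> matrix_inv_on (Pow D) A J K = 0"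
proof -
  let ?B = "tri_inv A" and ?C = "tri_inv (tri_inv A)"
  have fin: "finite J" if "J \<subseteq> D" for J using that D finite_subset by blast
  have AB: "(\<Sum>K\<in>Pow D. A J K * ?B K L) = (if J = L then 1 else 0)" if "J \<subseteq> D" for J L
    using tri_inv_right[of D A] assms that by blast
  have BC: "(\<Sum>K\<in>Pow D. ?B J K * ?C K L) = (if J = L then 1 else 0)" if "J \<subseteq> D" for J L
  proof (rule tri_inv_right[OF D _ _ that])
    show "tri_inv A J K = 0" if "J \<subseteq> D" "\<not> K \<subseteq> J" for J K
      using that fin tri_inv_triangular by blast
    show "tri_inv A J J \<noteq> 0" if "J \<subseteq> D" for J
      using that fin diag by (simp add: tri_inv_diag)
  qed
  have AC: "A J K = ?C J K" if "J \<subseteq> D" "K \<subseteq> D" for J K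
    using that AB BC D by (intro matrix_inverses_on_eq[of "Pow D" A ?B ?C]) auto
  have BA: "(\<Sum>K\<in>Pow D. ?B J K * A K L) = (if J = L then 1 else 0)" if "J \<subseteq> D" "L \<subseteq> D" for J L
  proof -
    have "(\<Sum>K\<in>Pow D. ?B J K * A K L) = (\<Sum>K\<in>Pow D. ?B J K * ?C K L)"
      using that AC by (intro sum.cong) auto
    then show ?thesis using BC that by simp
  qed
  \<comment> \<open>\<open>matrix_inv_on\<close> demands zeros outside the index set, which
    \<open>tri_inv\<close> does not guarantee.\<close>
  let ?B' = "\<lambda>J K. if J \<subseteq> D \<and> K \<subseteq> D then ?B J K else 0"
  have AB': "(\<Sum>K\<in>Pow D. A J K * ?B' K L) = (if J = L then 1 else 0)" if "J \<subseteq> D" "L \<subseteq> D" for J L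
  proof -
    have "(\<Sum>K\<in>Pow D. A J K * ?B' K L) = (\<Sum>K\<in>Pow D. A J K * ?B K L)"
      using that by (intro sum.cong) auto
    then show ?thesis using AB that by simp
  qed
  have BA': "(\<Sum>K\<in>Pow D. ?B' J K * A K L) = (if J = L then 1 else 0)" if "J \<subseteq> D" "L \<subseteq> D" for J L
  proof -
    have "(\<Sum>K\<in>Pow D. ?B' J K * A K L) = (\<Sum>K\<in>Pow D. ?B J K * A K L)"
      using that by (intro sum.cong) auto
    then show ?thesis using BA that by simp
  qed
  have inv: "matrix_inv_on (Pow D) A = ?B'"
    using D AB' BA' by (intro matrix_inv_on_eqI) auto
  show "(\<Sum>K\<in>Pow D. matrix_inv_on (Pow D) A J K * A K L) = (if J = L then 1 else 0)"
    if "J \<subseteq> D" "L \<subseteq> D" for J L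
    unfolding inv using BA' that by blast
  show "matrix_inv_on (Pow D) A J K = 0" if "J \<subseteq> D" "\<not> K \<subseteq> J" for J K
    unfolding inv using that tri_inv_triangular[OF fin[OF that(1)] that(2)] by simp
qed

section \<open>Finite reflection groups\<close>

text \<open>The product of sign vectors is written additively, because \<^theory>\<open>HOL-Library.Poly_Mapping\<close> builds
  the monoid algebra of an additive (here non-commutative) monoid.\<close>

datatype sign = Zer | Pos | Neg

instantiation sign :: monoid_add
begin

definition "0 = Zer"

definition "a + b = (if a = 0 then b else a)" for a b :: sign

instance
  by standard (auto simp: plus_sign_def)

end

lemma sign_add_eq_0_iff: "a + b = 0 \<longleftrightarrow> a = 0 \<and> b = (0::sign)"
  by (auto simp: plus_sign_def)

lemma sign_distinct [simp]: "Pos \<noteq> Neg" "Pos \<noteq> 0" "Neg \<noteq> 0" "0 \<noteq> Pos" "0 \<noteq> Neg"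
  by (auto simp: zero_sign_def)

definition sign_of :: "real \<Rightarrow> sign" where
  "sign_of r = (if r > 0 then Pos else if r < 0 then Neg else 0)"

lemma sign_of_simps [simp]:
  "sign_of r = 0 \<longleftrightarrow> r = 0" "sign_of r = Pos \<longleftrightarrow> r > 0" "sign_of r = Neg \<longleftrightarrow> r < 0"
  by (auto simp: sign_of_def)

lemma sign_of_uminus_eq_iff: "sign_of (- a) = sign_of (- b) \<longleftrightarrow> sign_of a = sign_of b"
  by (auto simp: sign_of_def)

lemma reflection_linear: "linear (reflection \<alpha>)"
  by (rule linearI)
    (auto simp: reflection_def inner_add_left algebra_simps add_divide_distrib)

lemma reflection_self: "\<alpha> \<noteq> 0 \<Longrightarrow> reflection \<alpha> \<alpha> = - \<alpha>"
  by (simp add: reflection_def scaleR_2)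

lemma reflection_inner: "\<alpha> \<noteq> 0 \<Longrightarrow> reflection \<alpha> v \<bullet> reflection \<alpha> u = v \<bullet> u"
  by (simp add: reflection_def inner_diff_left inner_diff_right inner_commute field_simps)

lemma reflection_involution: "\<alpha> \<noteq> 0 \<Longrightarrow> reflection \<alpha> (reflection \<alpha> v) = v"
  by (simp add: reflection_def inner_diff_left algebra_simps)

lemma reflection_uminus: "reflection (- \<alpha>) = reflection \<alpha>"
  by (auto simp: reflection_def fun_eq_iff)

lemma reflection_conjugate:
  assumes "linear w" "\<And>u v. w u \<bullet> w v = u \<bullet> v"
  shows "w (reflection \<alpha> v) = reflection (w \<alpha>) (w v)"
  by (simp add: reflection_def assms linear_diff linear_scale)

locale based_root_system =
  fixes \<Phi> \<Delta> :: "'a::euclidean_space set"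
  assumes root_sys: "root_system \<Phi>" and base: "root_base \<Phi> \<Delta>"
begin

abbreviation W :: "('a \<Rightarrow> 'a) set" where
  "W \<equiv> refl_group \<Phi>"

lemma finite_roots: "finite \<Phi>" and zero_not_root: "0 \<notin> \<Phi>"
  and reduced: "\<alpha> \<in> \<Phi> \<Longrightarrow> c *\<^sub>R \<alpha> \<in> \<Phi> \<Longrightarrow> c = 1 \<or> c = -1"
  and base_subset: "\<Delta> \<subseteq> \<Phi>" and base_independent: "independent \<Delta>"
  using root_sys base by (auto simp: root_system_def root_base_def)

lemma reflection_root: "\<alpha> \<in> \<Phi> \<Longrightarrow> \<beta> \<in> \<Phi> \<Longrightarrow> reflection \<alpha> \<beta> \<in> \<Phi>"
  using root_sys unfolding root_system_def by (metis imageI)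

lemma root_nonzero: "\<alpha> \<in> \<Phi> \<Longrightarrow> \<alpha> \<noteq> 0"
  using zero_not_root by auto

lemma uminus_root: "\<alpha> \<in> \<Phi> \<Longrightarrow> - \<alpha> \<in> \<Phi>"
  using reflection_root[of \<alpha> \<alpha>] by (simp add: reflection_self root_nonzero)

lemma finite_base [simp]: "finite \<Delta>"
  using base_subset finite_roots finite_subset by auto

subsection \<open>The reflection group\<close>

lemma W_linear: "w \<in> W \<Longrightarrow> linear w"
  by (induction rule: refl_group.induct) (simp_all only: linear_id linear_compose reflection_linear)

lemma W_inner: "w \<in> W \<Longrightarrow> w u \<bullet> w v = u \<bullet> v"
  by (induction rule: refl_group.induct) (auto simp: reflection_inner root_nonzero)

lemma W_root: "w \<in> W \<Longrightarrow> \<alpha> \<in> \<Phi> \<Longrightarrow> w \<alpha> \<in> \<Phi>"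
  by (induction rule: refl_group.induct) (auto simp: reflection_root)

lemma W_comp: "w \<in> W \<Longrightarrow> v \<in> W \<Longrightarrow> w \<circ> v \<in> W"
  by (induction rule: refl_group.induct) (simp_all add: o_assoc[symmetric] refl_group.step)

lemma reflection_in_W: "\<alpha> \<in> \<Phi> \<Longrightarrow> reflection \<alpha> \<in> W"
  using refl_group.step[OF _ refl_group.one, of \<alpha>] by simp

lemma W_inverse_ex: "w \<in> W \<Longrightarrow> \<exists>w'\<in>W. w' \<circ> w = id \<and> w \<circ> w' = id"
proof (induction rule: refl_group.induct)
  case one
  show ?case by (rule bexI[OF _ refl_group.one]) simp
next
  case (step \<alpha> w)
  then obtain w' where w': "w' \<in> W" "w' \<circ> w = id" "w \<circ> w' = id" by blast
  have "reflection \<alpha> \<circ> reflection \<alpha> = id"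
    by (simp add: fun_eq_iff reflection_involution root_nonzero step.hyps)
  then have "(w' \<circ> reflection \<alpha>) \<circ> (reflection \<alpha> \<circ> w) = id"
    "(reflection \<alpha> \<circ> w) \<circ> (w' \<circ> reflection \<alpha>) = id"
    using w' by (metis comp_assoc comp_id)+
  then show ?case using W_comp[OF w'(1) reflection_in_W[OF step.hyps(1)]] by blast
qed

lemma
  assumes "w \<in> W"
  shows W_bij: "bij w" and W_inv: "inv w \<in> W"
    and W_inv_apply [simp]: "inv w (w v) = v" and W_apply_inv [simp]: "w (inv w v) = v"
proof -
  obtain w' where w': "w' \<in> W" "w' \<circ> w = id" "w \<circ> w' = id"
    using W_inverse_ex assms by blast
  then show "bij w" using o_bij by blast
  then have "inv w = w'" using w' by (metis inv_unique_comp)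
  with w' show "inv w \<in> W" by simp
  show "inv w (w v) = v" "w (inv w v) = v"
    using w' \<open>inv w = w'\<close> by (auto simp: fun_eq_iff)
qed

lemma W_inner_inv: "w \<in> W \<Longrightarrow> w u \<bullet> v = u \<bullet> inv w v"
  by (metis W_apply_inv W_inner)

lemma W_root_iff: "w \<in> W \<Longrightarrow> w \<alpha> \<in> \<Phi> \<longleftrightarrow> \<alpha> \<in> \<Phi>"
  by (metis W_inv W_inv_apply W_root)

lemma W_uminus: "w \<in> W \<Longrightarrow> w (- \<alpha>) = - w \<alpha>"
  using W_linear linear_neg by blast

subsection \<open>Coordinates and positive roots\<close>

lemma coweight_ex:
  assumes "\<alpha> \<in> \<Delta>"
  shows "\<exists>v. \<forall>\<gamma>\<in>\<Delta>. v \<bullet> \<gamma> = (if \<gamma> = \<alpha> then 1 else 0)"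
proof -
  obtain g :: "'a \<Rightarrow> real" where g: "linear g" "\<forall>\<gamma>\<in>\<Delta>. g \<gamma> = (if \<gamma> = \<alpha> then 1 else 0)"
    using linear_independent_extend[OF base_independent, of "\<lambda>\<gamma>. if \<gamma> = \<alpha> then 1 else 0"] by auto
  \<comment> \<open>The functional \<open>g\<close> is represented by a vector: the inner product of
    the real number \<open>g \<gamma>\<close> with 1 is moved to the other side by the
    adjoint.\<close>
  have "adjoint g 1 \<bullet> \<gamma> = g \<gamma>" for \<gamma>
    using adjoint_works[OF g(1), of \<gamma> 1] by (simp add: inner_commute)
  then show ?thesis using g(2) by (intro exI[of _ "adjoint g 1"]) simp
qed

text \<open>The fundamental coweights, dual to the base. They are determined only up to vectors
  orthogonal to the span of the base, but they are only ever tested against vectors of that span,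
  where they read off coordinates.\<close>

definition coweight :: "'a \<Rightarrow> 'a" where
  "coweight \<alpha> = (SOME v. \<forall>\<gamma>\<in>\<Delta>. v \<bullet> \<gamma> = (if \<gamma> = \<alpha> then 1 else 0))"

lemma coweight_inner: "\<alpha> \<in> \<Delta> \<Longrightarrow> \<gamma> \<in> \<Delta> \<Longrightarrow> coweight \<alpha> \<bullet> \<gamma> = (if \<gamma> = \<alpha> then 1 else 0)"
  unfolding coweight_def using someI_ex[OF coweight_ex, of \<alpha>] by auto

lemma coweight_sum:
  assumes "\<alpha> \<in> \<Delta>"
  shows "coweight \<alpha> \<bullet> (\<Sum>\<gamma>\<in>\<Delta>. c \<gamma> *\<^sub>R \<gamma>) = c \<alpha>"
proof -
  have "coweight \<alpha> \<bullet> (\<Sum>\<gamma>\<in>\<Delta>. c \<gamma> *\<^sub>R \<gamma>) = (\<Sum>\<gamma>\<in>\<Delta>. if \<gamma> = \<alpha> then c \<gamma> else 0)"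
    unfolding inner_sum_right by (intro sum.cong) (auto simp: coweight_inner assms)
  then show ?thesis using assms by simp
qed

lemma span_base_expand:
  assumes "v \<in> span \<Delta>"
  shows "v = (\<Sum>\<gamma>\<in>\<Delta>. (coweight \<gamma> \<bullet> v) *\<^sub>R \<gamma>)"
proof -
  obtain c where c: "v = (\<Sum>\<gamma>\<in>\<Delta>. c \<gamma> *\<^sub>R \<gamma>)"
    using assms by (auto simp: span_finite)
  then show ?thesis by (simp add: coweight_sum)
qed

lemma nonneg_comb_iff:
  "v \<in> nonneg_comb \<Delta> \<longleftrightarrow> v \<in> span \<Delta> \<and> (\<forall>\<gamma>\<in>\<Delta>. 0 \<le> coweight \<gamma> \<bullet> v)"
proof
  assume "v \<in> nonneg_comb \<Delta>"
  then obtain c where "\<forall>\<gamma>\<in>\<Delta>. 0 \<le> c \<gamma>" "v = (\<Sum>\<gamma>\<in>\<Delta>. c \<gamma> *\<^sub>R \<gamma>)"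
    by (auto simp: nonneg_comb_def)
  then show "v \<in> span \<Delta> \<and> (\<forall>\<gamma>\<in>\<Delta>. 0 \<le> coweight \<gamma> \<bullet> v)"
    by (auto simp: coweight_sum span_sum span_scale span_base)
next
  assume "v \<in> span \<Delta> \<and> (\<forall>\<gamma>\<in>\<Delta>. 0 \<le> coweight \<gamma> \<bullet> v)"
  then show "v \<in> nonneg_comb \<Delta>"
    unfolding nonneg_comb_def using span_base_expand[of v]
    by (intro CollectI exI[of _ "\<lambda>\<gamma>. coweight \<gamma> \<bullet> v"]) blast
qed

definition pos :: "'a \<Rightarrow> bool" where
  "pos \<beta> \<longleftrightarrow> \<beta> \<in> \<Phi> \<and> \<beta> \<in> nonneg_comb \<Delta>"

lemma pos_root: "pos \<beta> \<Longrightarrow> \<beta> \<in> \<Phi>"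
  by (simp add: pos_def)

lemma pos_cases: "\<beta> \<in> \<Phi> \<Longrightarrow> pos \<beta> \<or> pos (- \<beta>)"
  using base uminus_root by (auto simp: pos_def root_base_def)

lemma root_span: "\<beta> \<in> \<Phi> \<Longrightarrow> \<beta> \<in> span \<Delta>"
  using pos_cases[of \<beta>] by (auto simp: pos_def nonneg_comb_iff dest: span_neg)

lemma root_expand: "\<beta> \<in> \<Phi> \<Longrightarrow> \<beta> = (\<Sum>\<gamma>\<in>\<Delta>. (coweight \<gamma> \<bullet> \<beta>) *\<^sub>R \<gamma>)"
  using root_span span_base_expand by blast

lemma pos_iff: "pos \<beta> \<longleftrightarrow> \<beta> \<in> \<Phi> \<and> (\<forall>\<gamma>\<in>\<Delta>. 0 \<le> coweight \<gamma> \<bullet> \<beta>)"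
  using root_span by (auto simp: pos_def nonneg_comb_iff)

lemma pos_uminus:
  assumes "\<beta> \<in> \<Phi>"
  shows "pos (- \<beta>) \<longleftrightarrow> \<not> pos \<beta>"
proof -
  have False if "pos \<beta>" "pos (- \<beta>)"
  proof -
    have "coweight \<gamma> \<bullet> \<beta> = 0" if "\<gamma> \<in> \<Delta>" for \<gamma>
      using that \<open>pos \<beta>\<close> \<open>pos (- \<beta>)\<close> by (auto simp: pos_iff intro!: antisym)
    then have "\<beta> = 0"
      by (subst root_expand[OF assms]) simp
    then show False using root_nonzero assms by simp
  qed
  then show ?thesis using pos_cases assms by auto
qed

lemma negative_roots_iff: "\<beta> \<in> negative_roots \<Phi> \<Delta> \<longleftrightarrow> \<beta> \<in> \<Phi> \<and> \<not> pos \<beta>"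
  using pos_uminus uminus_root by (auto simp: negative_roots_def pos_def)

lemma base_pos: "\<alpha> \<in> \<Delta> \<Longrightarrow> pos \<alpha>"
  using base_subset by (auto simp: pos_iff coweight_inner)

lemma base_root: "\<alpha> \<in> \<Delta> \<Longrightarrow> \<alpha> \<in> \<Phi>"
  using base_subset by auto

lemma base_nonzero: "\<alpha> \<in> \<Delta> \<Longrightarrow> \<alpha> \<noteq> 0"
  using base_root root_nonzero by blast

text \<open>Such a root is a multiple of \<open>\<alpha>\<close>; reducedness leaves the factors 1
  and -1, and positivity excludes -1.\<close>

lemma pos_multiple_base:
  assumes "pos \<beta>" "\<alpha> \<in> \<Delta>" "\<And>\<gamma>. \<gamma> \<in> \<Delta> \<Longrightarrow> \<gamma> \<noteq> \<alpha> \<Longrightarrow> coweight \<gamma> \<bullet> \<beta> = 0"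
  shows "\<beta> = \<alpha>"
proof -
  have "\<beta> = (\<Sum>\<gamma>\<in>\<Delta>. (coweight \<gamma> \<bullet> \<beta>) *\<^sub>R \<gamma>)"
    using assms root_expand pos_root by blast
  also have "\<dots> = (\<Sum>\<gamma>\<in>\<Delta>. if \<gamma> = \<alpha> then (coweight \<alpha> \<bullet> \<beta>) *\<^sub>R \<alpha> else 0)"
    using assms by (intro sum.cong) auto
  finally have b: "\<beta> = (coweight \<alpha> \<bullet> \<beta>) *\<^sub>R \<alpha>" using assms by simp
  then have "coweight \<alpha> \<bullet> \<beta> = 1 \<or> coweight \<alpha> \<bullet> \<beta> = -1"
    using reduced[of \<alpha> "coweight \<alpha> \<bullet> \<beta>"] assms base_root pos_root by metis
  moreover have "coweight \<alpha> \<bullet> \<beta> \<ge> 0" using assms by (auto simp: pos_iff)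
  ultimately show ?thesis using b by (metis neg_0_le_iff_le not_one_le_zero scaleR_one)
qed

text \<open>The reflection changes only the coordinate at \<open>\<alpha>\<close>. By
  \<open>pos_multiple_base\<close> some other coordinate of \<open>\<beta>\<close> is positive and
  stays so, and the coordinates of a root never have mixed signs.\<close>

lemma simple_reflection_pos:
  assumes "\<alpha> \<in> \<Delta>" "pos \<beta>" "\<beta> \<noteq> \<alpha>"
  shows "pos (reflection \<alpha> \<beta>)"
proof (rule ccontr)
  assume neg: "\<not> pos (reflection \<alpha> \<beta>)"
  have root: "reflection \<alpha> \<beta> \<in> \<Phi>"
    using assms base_root pos_root reflection_root by auto
  obtain \<gamma> where \<gamma>: "\<gamma> \<in> \<Delta>" "\<gamma> \<noteq> \<alpha>" "coweight \<gamma> \<bullet> \<beta> \<noteq> 0"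
    using pos_multiple_base assms by blast
  then have "coweight \<gamma> \<bullet> reflection \<alpha> \<beta> = coweight \<gamma> \<bullet> \<beta>"
    using assms by (simp add: reflection_def inner_diff_right coweight_inner)
  moreover have "coweight \<gamma> \<bullet> \<beta> > 0" using \<gamma> assms by (auto simp: pos_iff less_le)
  moreover have "coweight \<gamma> \<bullet> reflection \<alpha> \<beta> \<le> 0"
    using neg root pos_uminus[OF root] \<gamma> by (auto simp: pos_iff)
  ultimately show False by simp
qed

section \<open>The closed fundamental chamber\<close>

definition dominant :: "'a \<Rightarrow> bool" where
  "dominant v \<longleftrightarrow> (\<forall>\<alpha>\<in>\<Delta>. 0 \<le> v \<bullet> \<alpha>)"

lemma root_inner_expand: "\<beta> \<in> \<Phi> \<Longrightarrow> v \<bullet> \<beta> = (\<Sum>\<gamma>\<in>\<Delta>. (coweight \<gamma> \<bullet> \<beta>) * (v \<bullet> \<gamma>))"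
  by (subst root_expand) (auto simp: inner_sum_right)

lemma dominant_pos: "dominant v \<Longrightarrow> pos \<beta> \<Longrightarrow> 0 \<le> v \<bullet> \<beta>"
  by (subst root_inner_expand) (auto simp: pos_iff dominant_def intro!: sum_nonneg)

lemma dominant_eq_0_iff:
  assumes "dominant v" "pos \<beta>"
  shows "v \<bullet> \<beta> = 0 \<longleftrightarrow> (\<forall>\<gamma>\<in>\<Delta>. coweight \<gamma> \<bullet> \<beta> = 0 \<or> v \<bullet> \<gamma> = 0)"
proof -
  have "v \<bullet> \<beta> = (\<Sum>\<gamma>\<in>\<Delta>. (coweight \<gamma> \<bullet> \<beta>) * (v \<bullet> \<gamma>))"
    using assms root_inner_expand pos_root by blast
  moreover have "(\<Sum>\<gamma>\<in>\<Delta>. (coweight \<gamma> \<bullet> \<beta>) * (v \<bullet> \<gamma>)) = 0 \<longleftrightarrow>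
      (\<forall>\<gamma>\<in>\<Delta>. (coweight \<gamma> \<bullet> \<beta>) * (v \<bullet> \<gamma>) = 0)"
    using assms by (intro sum_nonneg_eq_0_iff) (auto simp: pos_iff dominant_def)
  ultimately show ?thesis by simp
qed

subsection \<open>Words in simple reflections\<close>

definition word :: "'a list \<Rightarrow> 'a \<Rightarrow> 'a" where
  "word as = foldr (\<lambda>\<alpha> w. reflection \<alpha> \<circ> w) as id"

lemma word_simps [simp]: "word [] = id" "word (\<alpha> # as) = reflection \<alpha> \<circ> word as"
  by (auto simp: word_def)

lemma word_append: "word (as @ bs) = word as \<circ> word bs"
  by (induction as) (auto simp: o_assoc)

lemma word_in_W: "set as \<subseteq> \<Delta> \<Longrightarrow> word as \<in> W"
  by (induction as) (auto simp del: id_apply intro: refl_group.intros base_root)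

text \<open>A positive root of minimal height in the orbit under the simple reflections must be simple.\<close>

lemma root_conjugate_base:
  assumes "pos \<beta>"
  shows "\<exists>as. set as \<subseteq> \<Delta> \<and> word as \<beta> \<in> \<Delta>"
proof -
  define R where "R = {\<gamma>. pos \<gamma> \<and> (\<exists>as. set as \<subseteq> \<Delta> \<and> word as \<beta> = \<gamma>)}"
  define h where "h = (\<Sum>\<alpha>\<in>\<Delta>. coweight \<alpha>)"
  have h: "h \<bullet> \<alpha> = 1" if "\<alpha> \<in> \<Delta>" for \<alpha>
    using that by (auto simp: h_def inner_sum_left coweight_inner)
  have "finite R"
    by (rule finite_subset[OF _ finite_roots]) (auto simp: R_def pos_root)
  moreover have "\<beta> \<in> R"
    using assms by (auto simp: R_def intro!: exI[of _ "[]"])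
  ultimately obtain \<gamma> where \<gamma>: "\<gamma> \<in> R" "\<And>\<delta>. \<delta> \<in> R \<Longrightarrow> h \<bullet> \<gamma> \<le> h \<bullet> \<delta>"
    using ex_min_if_finite[of "(\<lambda>\<gamma>. h \<bullet> \<gamma>) ` R"] by (auto simp: not_less)
  then obtain as where as: "set as \<subseteq> \<Delta>" "word as \<beta> = \<gamma>" and pg: "pos \<gamma>" by (auto simp: R_def)
  \<comment> \<open>Expanding the positive number \<open>\<gamma> \<bullet> \<gamma>\<close> in
    coordinates yields a simple root with positive inner product; reflecting in it lowers the height
    \<open>h \<bullet> \<gamma>\<close>.\<close>
  have "\<gamma> \<bullet> \<gamma> > 0" using pg pos_root root_nonzero by auto
  moreover have "\<gamma> \<bullet> \<gamma> = (\<Sum>\<delta>\<in>\<Delta>. (coweight \<delta> \<bullet> \<gamma>) * (\<gamma> \<bullet> \<delta>))"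
    using root_inner_expand pg pos_root by blast
  ultimately obtain \<alpha> where \<alpha>: "\<alpha> \<in> \<Delta>" "(coweight \<alpha> \<bullet> \<gamma>) * (\<gamma> \<bullet> \<alpha>) > 0"
    using sum_nonpos[of \<Delta> "\<lambda>\<delta>. (coweight \<delta> \<bullet> \<gamma>) * (\<gamma> \<bullet> \<delta>)"] by (metis leD not_le_imp_less)
  have "\<gamma> \<bullet> \<alpha> > 0"
    using \<alpha> pg by (auto simp: pos_iff zero_less_mult_iff)
  have "\<gamma> = \<alpha>"
  proof (rule ccontr)
    assume "\<gamma> \<noteq> \<alpha>"
    then have "pos (reflection \<alpha> \<gamma>)" using simple_reflection_pos \<alpha> pg by blast
    moreover have "word (\<alpha> # as) \<beta> = reflection \<alpha> \<gamma>" "set (\<alpha> # as) \<subseteq> \<Delta>"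
      using as \<alpha> by auto
    ultimately have "reflection \<alpha> \<gamma> \<in> R" unfolding R_def by blast
    then have "h \<bullet> \<gamma> \<le> h \<bullet> reflection \<alpha> \<gamma>" using \<gamma> by blast
    also have "\<dots> = h \<bullet> \<gamma> - 2 * (\<gamma> \<bullet> \<alpha>) / (\<alpha> \<bullet> \<alpha>)"
      using \<alpha> by (simp add: reflection_def inner_diff_right h)
    also have "\<dots> < h \<bullet> \<gamma>"
      using \<open>\<gamma> \<bullet> \<alpha> > 0\<close> \<alpha> base_root root_nonzero by simp
    finally show False by simp
  qed
  then show ?thesis using as \<alpha> by auto
qed

lemma word_rev: "set as \<subseteq> \<Delta> \<Longrightarrow> word (rev as) \<circ> word as = id"
proof (induction as)
  case (Cons \<alpha> as)
  have "word (rev as) (reflection \<alpha> (reflection \<alpha> v)) = word (rev as) v" for v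
    using Cons.prems by (simp add: reflection_involution base_nonzero)
  then show ?case using Cons by (auto simp: word_append fun_eq_iff)
qed auto

text \<open>If a word carries \<open>\<gamma>\<close> to a simple root, conjugating the simple
  reflection back by that word gives the reflection in \<open>\<gamma>\<close>.\<close>

lemma reflection_is_word:
  assumes "\<beta> \<in> \<Phi>"
  shows "\<exists>as. set as \<subseteq> \<Delta> \<and> word as = reflection \<beta>"
proof -
  have *: "\<exists>as. set as \<subseteq> \<Delta> \<and> word as = reflection \<gamma>" if pg: "pos \<gamma>" for \<gamma>
  proof -
    obtain as where as: "set as \<subseteq> \<Delta>" "word as \<gamma> \<in> \<Delta>"
      using root_conjugate_base[OF pg] by blast
    have "word (rev as @ [word as \<gamma>] @ as) v = reflection \<gamma> v" for v
    proof -
      have "reflection (word as \<gamma>) (word as v) = word as (reflection \<gamma> v)"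
        using reflection_conjugate word_in_W[OF as(1)] W_linear W_inner by metis
      then show ?thesis using word_rev[OF as(1)] by (simp add: word_append fun_eq_iff)
    qed
    then have "word (rev as @ [word as \<gamma>] @ as) = reflection \<gamma>" by blast
    moreover have "set (rev as @ [word as \<gamma>] @ as) \<subseteq> \<Delta>" using as by auto
    ultimately show ?thesis by blast
  qed
  show ?thesis
    using *[of \<beta>] *[of "- \<beta>"] pos_cases[OF assms] by (auto simp: reflection_uminus)
qed

lemma W_word: "w \<in> W \<Longrightarrow> \<exists>as. set as \<subseteq> \<Delta> \<and> word as = w"
proof (induction rule: refl_group.induct)
  case one
  then show ?case by (auto intro!: exI[of _ "[]"])
next
  case (step \<alpha> w)
  then obtain as bs where "set as \<subseteq> \<Delta>" "word as = w" "set bs \<subseteq> \<Delta>" "word bs = reflection \<alpha>"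
    using reflection_is_word by blast
  then show ?case by (intro exI[of _ "bs @ as"]) (auto simp: word_append)
qed

text \<open>Let the letters act on \<open>\<alpha>\<close> from the right. At the letter
  \<open>\<beta>\<close> that makes the image negative, the image just before must be
  \<open>\<beta>\<close> itself, the only positive root that this reflection makes negative.
  Conjugation then shows that multiplying by the reflection in \<open>\<alpha>\<close> deletes this
  letter.\<close>

lemma exchange:
  assumes "set as \<subseteq> \<Delta>" "\<alpha> \<in> \<Delta>" "\<not> pos (word as \<alpha>)"
  shows "\<exists>bs. set bs \<subseteq> \<Delta> \<and> length bs < length as \<and> word bs = word as \<circ> reflection \<alpha>"
  using assms
proof (induction as)
  case Nil
  then show ?case using base_pos by auto
next
  case (Cons \<beta> as)
  show ?case
  proof (cases "pos (word as \<alpha>)")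
    case False
    then obtain bs where "set bs \<subseteq> \<Delta>" "length bs < length as" "word bs = word as \<circ> reflection \<alpha>"
      using Cons.IH Cons.prems by (metis insert_subset list.simps(15))
    then show ?thesis
      using Cons.prems by (intro exI[of _ "\<beta> # bs"]) (auto simp: o_assoc)
  next
    case True
    then have eq: "word as \<alpha> = \<beta>"
      using Cons.prems simple_reflection_pos[of \<beta> "word as \<alpha>"] by auto
    have "word as \<in> W" using Cons.prems word_in_W by auto
    then have "word as (reflection \<alpha> v) = reflection \<beta> (word as v)" for v
      using reflection_conjugate W_linear W_inner eq by metis
    then have "word as = word (\<beta> # as) \<circ> reflection \<alpha>"
      using Cons.prems base_root root_nonzero by (auto simp: fun_eq_iff reflection_involution)
    moreover have "set as \<subseteq> \<Delta>" "length as < length (\<beta> # as)"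
      using Cons.prems by auto
    ultimately show ?thesis by metis
  qed
qed

lemma dominant_word:
  assumes "set as \<subseteq> \<Delta>" "dominant v" "dominant (word as v)"
  shows "word as v = v \<and> ((\<forall>\<alpha>\<in>\<Delta>. v \<bullet> \<alpha> \<noteq> 0) \<longrightarrow> word as = id)"
  using assms
proof (induction "length as" arbitrary: as rule: less_induct)
  case less
  show ?case
  proof (cases as rule: rev_cases)
    case Nil
    then show ?thesis by simp
  next
    case (snoc bs \<alpha>)
    have a: "\<alpha> \<in> \<Delta>" and bs: "set bs \<subseteq> \<Delta>" using snoc less.prems by auto
    have a0: "\<alpha> \<noteq> 0" using a base_root root_nonzero by auto
    have w: "word as = word bs \<circ> reflection \<alpha>" using snoc by (auto simp: word_append)
    have inW: "word as \<in> W" "word bs \<in> W" using less.prems bs word_in_W by auto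
    have neg: "word as \<alpha> = - word bs \<alpha>"
      using inW by (simp add: w reflection_self a0 W_uminus)
    show ?thesis
    proof (cases "pos (word as \<alpha>)")
      case True
      then have "\<not> pos (word bs \<alpha>)"
        using neg pos_uminus[of "word bs \<alpha>"] W_root inW a base_root by auto
      then obtain cs where "set cs \<subseteq> \<Delta>" "length cs < length bs" "word cs = word as"
        using exchange[OF bs a] w by metis
      then show ?thesis using less.hyps[of cs] less.prems snoc by auto
    next
      case False
      then have "pos (- word as \<alpha>)"
        using pos_uminus[of "word as \<alpha>"] W_root inW a base_root by auto
      then have "word as v \<bullet> (- word as \<alpha>) \<ge> 0" using dominant_pos less.prems by blast
      then have "v \<bullet> \<alpha> \<le> 0" using inW W_inner by simp
      then have 0: "v \<bullet> \<alpha> = 0" using less.prems a by (auto simp: dominant_def)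
      then have "word as v = word bs v" by (simp add: w reflection_def)
      then show ?thesis using less.hyps[of bs] less.prems snoc bs 0 a by auto
    qed
  qed
qed

lemma dominant_unique:
  "w \<in> W \<Longrightarrow> dominant v \<Longrightarrow> dominant (w v) \<Longrightarrow> w v = v"
  using dominant_word W_word by metis

lemma dominant_regular_id:
  "w \<in> W \<Longrightarrow> dominant v \<Longrightarrow> dominant (w v) \<Longrightarrow> \<forall>\<alpha>\<in>\<Delta>. v \<bullet> \<alpha> \<noteq> 0 \<Longrightarrow> w = id"
  using dominant_word W_word by metis

text \<open>Take \<open>w\<close> minimizing the number of positive roots that are negative on
  \<open>w v\<close>. If a simple root were among them, its reflection would remove it and merely
  permute the other positive roots, lowering the count.\<close>

lemma ex_dominant: "\<exists>w\<in>W. dominant (w v)"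
proof -
  define N where "N v = {\<beta>. pos \<beta> \<and> v \<bullet> \<beta> < 0}" for v
  have fin: "finite (N v)" for v
    by (rule finite_subset[OF _ finite_roots]) (auto simp: N_def pos_root)
  obtain w where w: "w \<in> W" "\<And>u. u \<in> W \<Longrightarrow> card (N (w v)) \<le> card (N (u v))"
    using ex_has_least_nat[of "\<lambda>w. w \<in> W" id "\<lambda>w. card (N (w v))"] refl_group.one by blast
  have "0 \<le> w v \<bullet> \<alpha>" if a: "\<alpha> \<in> \<Delta>" for \<alpha>
  proof (rule ccontr)
    assume neg: "\<not> 0 \<le> w v \<bullet> \<alpha>"
    let ?u = "reflection \<alpha> \<circ> w"
    have a0: "\<alpha> \<noteq> 0" using a base_root root_nonzero by auto
    have inner: "reflection \<alpha> x \<bullet> \<beta> = x \<bullet> reflection \<alpha> \<beta>" for x \<beta>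
      using reflection_inner[OF a0, of x "reflection \<alpha> \<beta>"] reflection_involution[OF a0] by simp
    have "reflection \<alpha> ` N (?u v) \<subseteq> N (w v) - {\<alpha>}"
    proof
      fix \<gamma> assume "\<gamma> \<in> reflection \<alpha> ` N (?u v)"
      then obtain \<beta> where b: "\<gamma> = reflection \<alpha> \<beta>" "pos \<beta>" "w v \<bullet> \<gamma> < 0"
        by (auto simp: N_def inner)
      have ne: "\<beta> \<noteq> \<alpha>" using b neg by (auto simp: reflection_self a0)
      then have "pos \<gamma>" using b a simple_reflection_pos by blast
      moreover have "\<gamma> \<noteq> \<alpha>"
      proof
        assume "\<gamma> = \<alpha>"
        then have "\<beta> = - \<alpha>" using b reflection_involution[OF a0, of \<beta>] reflection_self[OF a0] by simp
        then show False using b pos_uminus[of \<alpha>] base_pos base_root a by auto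
      qed
      ultimately show "\<gamma> \<in> N (w v) - {\<alpha>}" using b by (auto simp: N_def)
    qed
    then have "card (reflection \<alpha> ` N (?u v)) \<le> card (N (w v) - {\<alpha>})"
      using fin by (intro card_mono) auto
    moreover have "card (reflection \<alpha> ` N (?u v)) = card (N (?u v))"
      by (intro card_image inj_on_inverseI[of _ "reflection \<alpha>"]) (simp add: reflection_involution a0)
    moreover have "\<alpha> \<in> N (w v)" using a base_pos neg by (auto simp: N_def)
    then have "card (N (w v) - {\<alpha>}) < card (N (w v))" using fin by (intro psubset_card_mono) auto
    moreover have "?u \<in> W" using w a base_root refl_group.step by blast
    then have "card (N (w v)) \<le> card (N (?u v))" using w by blast
    ultimately show False by simp
  qed
  then show ?thesis using w by (auto simp: dominant_def)
qed

subsection \<open>Faces of the reflection arrangement\<close>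

text \<open>Signs are recorded on all roots, not only on positive ones, so that the group acts by
  moving arguments without sign corrections. The value 0 off the roots makes equality of faces
  equality of functions, and pointwise addition is the Tits product.\<close>

definition face :: "'a \<Rightarrow> 'a \<Rightarrow> sign" where
  "face v = (\<lambda>\<beta>. if \<beta> \<in> \<Phi> then sign_of (v \<bullet> \<beta>) else 0)"

definition faces :: "('a \<Rightarrow> sign) set" where
  "faces = range face"

definition zero_set :: "('a \<Rightarrow> sign) \<Rightarrow> 'a set" where
  "zero_set F = {\<beta> \<in> \<Phi>. F \<beta> = 0}"

lemma face_in_faces [simp]: "face v \<in> faces"
  by (simp add: faces_def)

lemma faces_outside: "F \<in> faces \<Longrightarrow> \<beta> \<notin> \<Phi> \<Longrightarrow> F \<beta> = 0"
  by (auto simp: faces_def face_def)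

lemma finite_faces: "finite faces"
proof (rule finite_subset)
  have "(UNIV :: sign set) = {Zer, Pos, Neg}"
    using sign.exhaust by auto
  then have "finite (UNIV :: sign set)" by (metis finite.emptyI finite_insert)
  then show "finite {F :: 'a \<Rightarrow> sign. \<forall>\<beta>. (\<beta> \<in> \<Phi> \<longrightarrow> F \<beta> \<in> UNIV) \<and> (\<beta> \<notin> \<Phi> \<longrightarrow> F \<beta> = 0)}"
    by (intro finite_set_of_finite_funs finite_roots)
  show "faces \<subseteq> {F. \<forall>\<beta>. (\<beta> \<in> \<Phi> \<longrightarrow> F \<beta> \<in> UNIV) \<and> (\<beta> \<notin> \<Phi> \<longrightarrow> F \<beta> = 0)}"
    using faces_outside by auto
qed

text \<open>Geometrically the product is the face entered when one starts at \<open>v\<close> and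
  moves a little towards \<open>u\<close>. As there are finitely many roots, one small step size
  \<open>e\<close> preserves all nonzero signs of \<open>v\<close>.\<close>

lemma face_add_ex: "\<exists>w. face v + face u = face w"
proof -
  have "\<forall>\<^sub>F e in at_right 0. \<forall>\<beta>\<in>\<Phi>. v \<bullet> \<beta> \<noteq> 0 \<longrightarrow> e * \<bar>u \<bullet> \<beta>\<bar> < \<bar>v \<bullet> \<beta>\<bar>"
  proof (intro eventually_ball_finite finite_roots ballI)
    fix \<beta>
    have "((\<lambda>e::real. e * \<bar>u \<bullet> \<beta>\<bar>) \<longlongrightarrow> 0 * \<bar>u \<bullet> \<beta>\<bar>) (at_right 0)"
      by (intro tendsto_intros)
    then have "\<forall>\<^sub>F e in at_right 0. e * \<bar>u \<bullet> \<beta>\<bar> < \<bar>v \<bullet> \<beta>\<bar>" if "v \<bullet> \<beta> \<noteq> 0"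
      using order_tendstoD(2)[of _ "0 * \<bar>u \<bullet> \<beta>\<bar>" "at_right 0" "\<bar>v \<bullet> \<beta>\<bar>"] that by simp
    then show "\<forall>\<^sub>F e in at_right 0. v \<bullet> \<beta> \<noteq> 0 \<longrightarrow> e * \<bar>u \<bullet> \<beta>\<bar> < \<bar>v \<bullet> \<beta>\<bar>"
      by (cases "v \<bullet> \<beta> = 0") auto
  qed
  moreover have "\<forall>\<^sub>F e::real in at_right 0. e > 0"
    by (simp add: eventually_at_right_less)
  ultimately have "\<forall>\<^sub>F e in at_right (0::real). e > 0 \<and>
      (\<forall>\<beta>\<in>\<Phi>. v \<bullet> \<beta> \<noteq> 0 \<longrightarrow> e * \<bar>u \<bullet> \<beta>\<bar> < \<bar>v \<bullet> \<beta>\<bar>)"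
    by eventually_elim auto
  then obtain e :: real where e: "e > 0" "\<And>\<beta>. \<beta> \<in> \<Phi> \<Longrightarrow> v \<bullet> \<beta> \<noteq> 0 \<Longrightarrow> e * \<bar>u \<bullet> \<beta>\<bar> < \<bar>v \<bullet> \<beta>\<bar>"
    using eventually_happens'[OF trivial_limit_at_right_real] by blast
  have "(face v + face u) \<beta> = face (v + e *\<^sub>R u) \<beta>" for \<beta>
  proof (cases "\<beta> \<in> \<Phi>")
    case True
    have "\<bar>e * (u \<bullet> \<beta>)\<bar> < \<bar>v \<bullet> \<beta>\<bar>" if "v \<bullet> \<beta> \<noteq> 0"
      using e(2)[OF True that] e(1) by (simp add: abs_mult)
    then show ?thesis
      using True e(1)
      by (cases "v \<bullet> \<beta> = 0") (auto simp: face_def plus_sign_def sign_of_def inner_add_left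
          zero_less_mult_iff mult_less_0_iff)
  qed (simp add: face_def)
  then show ?thesis by blast
qed

sublocale left_regular_band faces zero_set
proof
  show "finite faces" by (rule finite_faces)
  show "F + G \<in> faces" if "F \<in> faces" "G \<in> faces" for F G
    using that face_add_ex by (auto simp: faces_def) (metis rangeI)
  show "zero_set (F + G) = zero_set F \<inter> zero_set G" for F G
    by (auto simp: zero_set_def sign_add_eq_0_iff)
  show "F + G = F" if "F \<in> faces" "G \<in> faces" "zero_set F \<subseteq> zero_set G" for F G
  proof
    fix \<beta>
    have "F \<beta> = 0 \<Longrightarrow> G \<beta> = 0"
      using that faces_outside by (cases "\<beta> \<in> \<Phi>") (auto simp: zero_set_def)
    then show "(F + G) \<beta> = F \<beta>" by (auto simp: plus_sign_def)
  qed
qed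

lemma face_uminus_iff:
  assumes "F \<in> faces" "\<beta> \<in> \<Phi>"
  shows "F (- \<beta>) = Pos \<longleftrightarrow> F \<beta> = Neg" "F (- \<beta>) = Neg \<longleftrightarrow> F \<beta> = Pos" "F (- \<beta>) = 0 \<longleftrightarrow> F \<beta> = 0"
  using assms uminus_root by (auto simp: faces_def face_def)

lemma faces_eqI:
  assumes "F \<in> faces" "G \<in> faces" "\<And>\<beta>. pos \<beta> \<Longrightarrow> F \<beta> = G \<beta>"
  shows "F = G"
proof
  fix \<beta>
  show "F \<beta> = G \<beta>"
  proof (cases "\<beta> \<in> \<Phi>")
    case True
    obtain u v where uv: "F = face u" "G = face v" using assms by (auto simp: faces_def)
    have "F (- \<beta>) = G (- \<beta>) \<longleftrightarrow> F \<beta> = G \<beta>"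
      using True uminus_root by (simp add: uv face_def sign_of_uminus_eq_iff)
    then show ?thesis using pos_cases[OF True] assms(3) by auto
  qed (simp add: faces_outside assms(1,2))
qed

section \<open>The action of the group on faces\<close>

definition act :: "('a \<Rightarrow> 'a) \<Rightarrow> ('a \<Rightarrow> sign) \<Rightarrow> 'a \<Rightarrow> sign" where
  "act w F = (\<lambda>\<beta>. F (inv w \<beta>))"

lemma act_face: "w \<in> W \<Longrightarrow> act w (face v) = face (w v)"
  using W_root_iff[OF W_inv] by (auto simp: act_def face_def fun_eq_iff W_inner_inv)

lemma act_faces: "w \<in> W \<Longrightarrow> F \<in> faces \<Longrightarrow> act w F \<in> faces"
  by (auto simp: faces_def act_face)

lemma act_add: "act w (F + G) = act w F + act w G"
  by (auto simp: act_def)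

lemma act_id [simp]: "act id F = F"
  by (simp add: act_def)

lemma act_act: "w \<in> W \<Longrightarrow> v \<in> W \<Longrightarrow> act w (act v F) = act (w \<circ> v) F"
  by (simp add: act_def o_inv_distrib W_bij)

lemma W_inv_comp: "w \<in> W \<Longrightarrow> inv w \<circ> w = id" "w \<in> W \<Longrightarrow> w \<circ> inv w = id"
  by (auto simp: fun_eq_iff)

lemma act_inv [simp]: "w \<in> W \<Longrightarrow> act (inv w) (act w F) = F" "w \<in> W \<Longrightarrow> act w (act (inv w) F) = F"
  using W_inv by (simp_all add: act_act W_inv_comp del: id_apply)

lemma act_apply: "w \<in> W \<Longrightarrow> act w F (w \<beta>) = F \<beta>"
  by (simp add: act_def)

lemma zero_set_act:
  assumes "w \<in> W"
  shows "zero_set (act w F) = w ` zero_set F"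
proof -
  have "\<beta> \<in> w ` zero_set F" if "\<beta> \<in> zero_set (act w F)" for \<beta>
    using that assms W_root_iff[OF W_inv[OF assms]]
    by (intro image_eqI[of _ _ "inv w \<beta>"]) (auto simp: zero_set_def act_def)
  then show ?thesis
    using assms by (auto simp: zero_set_def act_apply W_root)
qed

lemma fiber_card_image:
  assumes "w \<in> W"
  shows "fiber_card (w ` X) = fiber_card X"
proof -
  have "inv w ` w ` X = X" for X using assms by (auto simp: image_image)
  then have "bij_betw (act w) (fiber X) (fiber (w ` X))"
    using assms W_inv[OF assms]
    by (intro bij_betwI[of _ _ _ "act (inv w)"]) (auto simp: fiber_def zero_set_act act_faces)
  then show ?thesis
    by (simp add: fiber_card_def bij_betw_same_card)
qed

subsection \<open>Standard faces\<close>

text \<open>A representative point of the face of the fundamental chamber on which exactly the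
  simple roots in \<open>J\<close> vanish. The empty set gives the open chamber, the whole base
  gives the origin.\<close>

definition std_point :: "'a set \<Rightarrow> 'a" where
  "std_point J = (\<Sum>\<alpha>\<in>\<Delta> - J. coweight \<alpha>)"

definition std_face :: "'a set \<Rightarrow> 'a \<Rightarrow> sign" where
  "std_face J = face (std_point J)"

abbreviation C0 :: "'a \<Rightarrow> sign" where
  "C0 \<equiv> std_face {}"

lemma std_face_in_faces [simp]: "std_face J \<in> faces"
  by (simp add: std_face_def)

lemma std_point_inner: "\<gamma> \<in> \<Delta> \<Longrightarrow> std_point J \<bullet> \<gamma> = (if \<gamma> \<in> J then 0 else 1)"
  by (auto simp: std_point_def inner_sum_left coweight_inner)

lemma dominant_std_point: "dominant (std_point J)"
  by (simp add: dominant_def std_point_inner)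

lemma span_subset_iff:
  assumes "J \<subseteq> \<Delta>" "v \<in> span \<Delta>"
  shows "v \<in> span J \<longleftrightarrow> (\<forall>\<gamma>\<in>\<Delta> - J. coweight \<gamma> \<bullet> v = 0)"
proof
  assume "v \<in> span J"
  moreover have "subspace {v. \<forall>\<gamma>\<in>\<Delta> - J. coweight \<gamma> \<bullet> v = 0}"
    by (auto simp: subspace_def inner_add_right)
  moreover have "J \<subseteq> {v. \<forall>\<gamma>\<in>\<Delta> - J. coweight \<gamma> \<bullet> v = 0}"
    using assms by (auto simp: coweight_inner)
  ultimately show "\<forall>\<gamma>\<in>\<Delta> - J. coweight \<gamma> \<bullet> v = 0"
    using span_minimal by blast
next
  assume 0: "\<forall>\<gamma>\<in>\<Delta> - J. coweight \<gamma> \<bullet> v = 0"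
  have "v = (\<Sum>\<gamma>\<in>\<Delta>. (coweight \<gamma> \<bullet> v) *\<^sub>R \<gamma>)" using assms span_base_expand by blast
  also have "\<dots> = (\<Sum>\<gamma>\<in>J. (coweight \<gamma> \<bullet> v) *\<^sub>R \<gamma>)"
    using assms 0 by (intro sum.mono_neutral_right) auto
  also have "\<dots> \<in> span J" by (intro span_sum span_scale span_base)
  finally show "v \<in> span J" .
qed

lemma std_eval_pos:
  assumes "J \<subseteq> \<Delta>" "pos \<beta>"
  shows "std_face J \<beta> = (if \<beta> \<in> span J then 0 else Pos)"
proof -
  have "std_point J \<bullet> \<beta> = 0 \<longleftrightarrow> \<beta> \<in> span J"
    using assms dominant_std_point by (subst dominant_eq_0_iff)
      (auto simp: span_subset_iff root_span pos_root std_point_inner)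
  moreover have "std_point J \<bullet> \<beta> \<ge> 0" using assms dominant_std_point dominant_pos by blast
  ultimately show ?thesis using assms pos_root by (auto simp: std_face_def face_def sign_of_def)
qed

lemma C0_eval: "C0 \<beta> = (if pos \<beta> then Pos else if \<beta> \<in> \<Phi> then Neg else 0)"
proof -
  consider "pos \<beta>" | "\<beta> \<in> \<Phi>" "pos (- \<beta>)" "\<not> pos \<beta>" | "\<beta> \<notin> \<Phi>"
    using pos_uminus by blast
  then show ?thesis
  proof cases
    case 1
    then show ?thesis using std_eval_pos[of "{}" \<beta>] root_nonzero pos_root by auto
  next
    case 2
    have "- \<beta> \<noteq> 0" using 2 root_nonzero by auto
    then have "C0 (- \<beta>) = Pos" using std_eval_pos[of "{}" "- \<beta>"] 2 by auto
    then show ?thesis using face_uminus_iff[of C0 \<beta>] 2 by auto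
  next
    case 3
    then show ?thesis using pos_root by (auto simp: faces_outside)
  qed
qed

lemma std_eval:
  assumes "J \<subseteq> \<Delta>"
  shows "std_face J \<beta> = (if \<beta> \<in> span J then 0 else C0 \<beta>)"
proof -
  consider "pos \<beta>" | "\<beta> \<in> \<Phi>" "pos (- \<beta>)" "\<not> pos \<beta>" | "\<beta> \<notin> \<Phi>"
    using pos_uminus by blast
  then show ?thesis
  proof cases
    case 1
    then show ?thesis using std_eval_pos[OF assms] C0_eval by auto
  next
    case 2
    have "- \<beta> \<in> span J \<longleftrightarrow> \<beta> \<in> span J" using span_neg[of \<beta> J] span_neg[of "- \<beta>" J] by auto
    then show ?thesis
      using face_uminus_iff[of "std_face J" \<beta>] std_eval_pos[OF assms 2(2)] 2 C0_eval by auto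
  next
    case 3
    then show ?thesis by (simp add: faces_outside)
  qed
qed

lemma std_base_eq_0_iff: "\<alpha> \<in> \<Delta> \<Longrightarrow> std_face J \<alpha> = 0 \<longleftrightarrow> \<alpha> \<in> J"
  using base_root by (auto simp: std_face_def face_def std_point_inner)

lemma std_inj: "J \<subseteq> \<Delta> \<Longrightarrow> K \<subseteq> \<Delta> \<Longrightarrow> std_face J = std_face K \<Longrightarrow> J = K"
  using std_base_eq_0_iff by (metis subset_antisym subset_eq)

lemma C0_eq_Pos_iff: "C0 \<beta> = Pos \<longleftrightarrow> pos \<beta>"
  by (auto simp: C0_eval)

lemma C0_eq_0_iff: "C0 \<beta> = 0 \<longleftrightarrow> \<beta> \<notin> \<Phi>"
  using pos_root by (auto simp: C0_eval)

lemma zero_set_std_face: "J \<subseteq> \<Delta> \<Longrightarrow> zero_set (std_face J) = \<Phi> \<inter> span J"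
  by (auto simp: zero_set_def std_eval C0_eval)

lemma zero_set_C0: "zero_set C0 = {}"
  by (auto simp: zero_set_def C0_eval)

text \<open>A representative of \<open>F\<close> is dominant, and the signs of a dominant vector on
  the positive roots depend only on which simple roots vanish at it.\<close>

lemma face_of_C0:
  assumes "F \<in> faces" "\<And>\<beta>. pos \<beta> \<Longrightarrow> F \<beta> \<noteq> Neg"
  shows "\<exists>J\<subseteq>\<Delta>. F = std_face J"
proof -
  obtain v where v: "F = face v" using assms by (auto simp: faces_def)
  let ?J = "{\<alpha> \<in> \<Delta>. v \<bullet> \<alpha> = 0}"
  have dom: "dominant v"
    using assms(2)[OF base_pos] base_root by (auto simp: dominant_def v face_def not_less)
  have "F = std_face ?J"
  proof (rule faces_eqI)
    fix \<beta> assume b: "pos \<beta>"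
    have "v \<bullet> \<beta> = 0 \<longleftrightarrow> \<beta> \<in> span ?J"
      using dominant_eq_0_iff[OF dom b] b by (auto simp: span_subset_iff root_span pos_root)
    then show "F \<beta> = std_face ?J \<beta>"
      using dominant_pos[OF dom b] pos_root[OF b] std_eval_pos[OF _ b, of ?J]
      by (auto simp: v face_def sign_of_def)
  qed (use assms in auto)
  then show ?thesis by (intro exI[of _ ?J]) simp
qed

lemma dominant_face:
  assumes "dominant v"
  shows "\<exists>J\<subseteq>\<Delta>. face v = std_face J"
proof (rule face_of_C0)
  show "face v \<beta> \<noteq> Neg" if "pos \<beta>" for \<beta>
    using dominant_pos[OF assms that] by (auto simp: face_def)
qed simp

lemma face_dominantI:
  assumes "face v = std_face J"
  shows "dominant v"
proof -
  have "v \<bullet> \<alpha> \<ge> 0" if "\<alpha> \<in> \<Delta>" for \<alpha>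
  proof -
    have "sign_of (v \<bullet> \<alpha>) = sign_of (std_point J \<bullet> \<alpha>)"
      using fun_cong[OF assms, of \<alpha>] that base_root by (auto simp: std_face_def face_def)
    then show ?thesis using that by (auto simp: std_point_inner sign_of_def split: if_splits)
  qed
  then show ?thesis by (simp add: dominant_def)
qed

text \<open>The representative point of the first face is moved to a dominant vector, hence is
  fixed. Thus no two distinct standard faces lie in one orbit, which makes the type of a face well
  defined.\<close>

lemma std_type_unique:
  assumes "w \<in> W" "J \<subseteq> \<Delta>" "K \<subseteq> \<Delta>" "act w (std_face J) = std_face K"
  shows "J = K"
proof -
  have "face (w (std_point J)) = std_face K" using assms by (simp add: std_face_def act_face)
  moreover from this have "w (std_point J) = std_point J"
    using assms face_dominantI dominant_std_point dominant_unique by blast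
  ultimately show ?thesis using assms std_inj by (simp add: std_face_def)
qed

lemma act_C0_eq_C0:
  assumes "w \<in> W" "act w C0 = C0"
  shows "w = id"
proof -
  have "face (w (std_point {})) = C0" using assms by (simp add: std_face_def act_face)
  then show ?thesis
    using assms face_dominantI dominant_std_point by (intro dominant_regular_id[of w "std_point {}"]) (auto simp: std_point_inner)
qed

lemma act_C0_inj:
  assumes "w \<in> W" "v \<in> W" "act w C0 = act v C0"
  shows "w = v"
proof -
  have "act (inv v \<circ> w) C0 = C0"
    using assms W_inv by (simp add: act_act[symmetric])
  then have "inv v \<circ> w = id" using assms W_inv W_comp act_C0_eq_C0 by blast
  then have "v \<circ> inv v \<circ> w = v" by (metis comp_assoc comp_id)
  then show ?thesis using assms by (simp add: W_inv_comp)
qed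

text \<open>No root vanishes on \<open>F + C0\<close>. Moving it into the fundamental chamber makes
  it a standard face with empty zero set, which can only be \<open>C0\<close>.\<close>

lemma chamber_ex:
  assumes "F \<in> faces"
  shows "\<exists>w\<in>W. F + C0 = act w C0"
proof -
  have "F + C0 \<in> faces" using assms add_closed by simp
  then obtain x where x: "F + C0 = face x" by (auto simp: faces_def)
  obtain w where w: "w \<in> W" "dominant (w x)" using ex_dominant by blast
  have "\<exists>J\<subseteq>\<Delta>. face (w x) = std_face J"
    using w(2) dominant_face by blast
  then obtain J where J: "J \<subseteq> \<Delta>" "act w (F + C0) = std_face J" using w x by (auto simp: act_face)
  have "zero_set (std_face J) = {}"
    using J(2)[symmetric] w assms by (simp add: zero_set_act z_add zero_set_C0)
  then have "J = {}" using J zero_set_std_face[of J] base_root by (auto intro: span_base)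
  then have "F + C0 = act (inv w) C0" using J w by (metis act_inv(1))
  then show ?thesis using w W_inv by blast
qed

text \<open>A left summand keeps its nonzero signs in the product. After pulling back by
  \<open>w\<close> the product is \<open>C0\<close>, so the pulled back \<open>F\<close> is nowhere
  negative on positive roots.\<close>

lemma chamber_face:
  assumes "F \<in> faces" "w \<in> W" "F + C0 = act w C0"
  shows "\<exists>K\<subseteq>\<Delta>. act (inv w) F = std_face K"
proof (rule face_of_C0)
  show "act (inv w) F \<in> faces" using assms W_inv act_faces by blast
  have "act (inv w) F + act (inv w) C0 = C0"
    using assms by (metis act_add act_inv(1))
  then show "act (inv w) F \<beta> \<noteq> Neg" if "pos \<beta>" for \<beta>
    using that C0_eq_Pos_iff[of \<beta>]
    by (metis plus_fun_apply plus_sign_def sign_distinct(1,3))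
qed

lemma W_finite: "finite W"
proof (rule inj_on_finite[of "\<lambda>w. act w C0"])
  show "inj_on (\<lambda>w. act w C0) W" using act_C0_inj by (auto simp: inj_on_def)
  show "(\<lambda>w. act w C0) ` W \<subseteq> faces" using act_faces by auto
qed (rule finite_faces)

section \<open>Orbits of faces and their types\<close>

definition faces_of_type :: "'a set \<Rightarrow> ('a \<Rightarrow> sign) set" where
  "faces_of_type J = (\<lambda>w. act w (std_face J)) ` W"

lemma faces_of_type_subset: "faces_of_type J \<subseteq> faces"
  by (auto simp: faces_of_type_def act_faces)

lemma finite_faces_of_type [simp]: "finite (faces_of_type J)"
  using faces_of_type_subset finite_faces finite_subset by blast

lemma act_faces_of_type_iff:
  assumes "w \<in> W"
  shows "act w F \<in> faces_of_type J \<longleftrightarrow> F \<in> faces_of_type J"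
proof -
  have *: "act u F \<in> faces_of_type J" if "u \<in> W" "F \<in> faces_of_type J" for u F
    using that W_comp by (auto simp: faces_of_type_def act_act)
  show ?thesis using *[OF assms, of F] *[OF W_inv[OF assms], of "act w F"] assms by auto
qed

lemma std_face_in_faces_of_type: "std_face J \<in> faces_of_type J"
  unfolding faces_of_type_def by (rule image_eqI[OF _ refl_group.one]) simp

lemma std_face_in_faces_of_type_iff:
  assumes "J \<subseteq> \<Delta>" "K \<subseteq> \<Delta>"
  shows "std_face K \<in> faces_of_type J \<longleftrightarrow> K = J"
proof
  assume "std_face K \<in> faces_of_type J"
  then obtain w where "w \<in> W" "act w (std_face J) = std_face K" by (auto simp: faces_of_type_def)
  then show "K = J" using assms std_type_unique by blast
qed (simp add: std_face_in_faces_of_type)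

lemma faces_of_type_disjoint:
  assumes "J \<subseteq> \<Delta>" "K \<subseteq> \<Delta>" "J \<noteq> K"
  shows "faces_of_type J \<inter> faces_of_type K = {}"
proof -
  have "\<not> act w (std_face K) \<in> faces_of_type J" if "w \<in> W" for w
    using act_faces_of_type_iff[OF that] std_face_in_faces_of_type_iff assms by auto
  then show ?thesis by (auto simp: faces_of_type_def[of K])
qed

lemma faces_eq_Union_faces_of_type: "faces = (\<Union>J\<in>Pow \<Delta>. faces_of_type J)"
proof -
  have "\<exists>J\<in>Pow \<Delta>. F \<in> faces_of_type J" if F: "F \<in> faces" for F
  proof -
    obtain x where x: "F = face x" using F by (auto simp: faces_def)
    obtain w where w: "w \<in> W" "dominant (w x)" using ex_dominant by blast
    have "\<exists>J\<subseteq>\<Delta>. face (w x) = std_face J"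
      using w(2) dominant_face by blast
    then obtain J where "J \<subseteq> \<Delta>" "act w F = std_face J" using w x by (auto simp: act_face)
    then show ?thesis using act_faces_of_type_iff[OF w(1), of F J] std_face_in_faces_of_type by auto
  qed
  then show ?thesis using faces_of_type_subset by auto
qed

section \<open>Descent sets and projections of the fundamental chamber\<close>

lemma X_set_iff: "J \<subseteq> \<Delta> \<Longrightarrow> w \<in> X_set \<Phi> \<Delta> J \<longleftrightarrow> w \<in> W \<and> (\<forall>\<alpha>\<in>J. pos (w \<alpha>))"
  unfolding X_set_def Des_def negative_roots_iff using W_root base_root by blast

lemma pos_image:
  assumes "w \<in> W" "J \<subseteq> \<Delta>" "\<And>\<alpha>. \<alpha> \<in> J \<Longrightarrow> pos (w \<alpha>)" "pos \<beta>" "\<beta> \<in> span J"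
  shows "pos (w \<beta>)"
proof -
  have root: "\<beta> \<in> \<Phi>" using assms pos_root by blast
  have lin: "linear w" using assms W_linear by blast
  have "w \<beta> = w (\<Sum>\<delta>\<in>\<Delta>. (coweight \<delta> \<bullet> \<beta>) *\<^sub>R \<delta>)" using root_expand[OF root] by simp
  also have "\<dots> = (\<Sum>\<delta>\<in>\<Delta>. (coweight \<delta> \<bullet> \<beta>) *\<^sub>R w \<delta>)"
    using lin by (simp add: linear_sum linear_scale)
  finally have w: "w \<beta> = (\<Sum>\<delta>\<in>\<Delta>. (coweight \<delta> \<bullet> \<beta>) *\<^sub>R w \<delta>)" .
  have "0 \<le> coweight \<gamma> \<bullet> w \<beta>" if g: "\<gamma> \<in> \<Delta>" for \<gamma>
    unfolding w inner_sum_right inner_scaleR_right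
  proof (intro sum_nonneg)
    fix \<delta> assume d: "\<delta> \<in> \<Delta>"
    show "0 \<le> (coweight \<delta> \<bullet> \<beta>) * (coweight \<gamma> \<bullet> w \<delta>)"
    proof (cases "\<delta> \<in> J")
      case True
      then show ?thesis using assms g d by (auto simp: pos_iff)
    next
      case False
      then have "coweight \<delta> \<bullet> \<beta> = 0" using assms d span_subset_iff[of J \<beta>] root_span[OF root] by auto
      then show ?thesis by simp
    qed
  qed
  then show ?thesis using assms W_root root by (auto simp: pos_iff)
qed

lemma C0_image:
  assumes "w \<in> W" "J \<subseteq> \<Delta>" "\<And>\<alpha>. \<alpha> \<in> J \<Longrightarrow> pos (w \<alpha>)" "\<beta> \<in> span J"
  shows "C0 (w \<beta>) = C0 \<beta>"
proof (cases "\<beta> \<in> \<Phi>")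
  case True
  have "- \<beta> \<in> span J" using assms span_neg by blast
  then have "pos (w \<beta>) \<longleftrightarrow> pos \<beta>"
    using pos_image[OF assms(1-3), of \<beta>] pos_image[OF assms(1-3), of "- \<beta>"] assms
      pos_uminus[OF True] pos_uminus[of "w \<beta>"] W_root[OF assms(1) True] W_uminus[of w \<beta>] by auto
  then show ?thesis using True assms W_root by (simp add: C0_eval)
next
  case False
  then show ?thesis using faces_outside[of C0] W_root_iff assms by auto
qed

text \<open>The moved face vanishes exactly on the roots of the moved span of \<open>J\<close>.
  There the product takes the sign from \<open>C0\<close>, which agrees with the moved chamber since
  \<open>w\<close> preserves positivity on the span of \<open>J\<close>. On all other roots the face
  already has the signs of the moved chamber.\<close>

lemma X_set_std_add_C0:
  assumes "J \<subseteq> \<Delta>" "w \<in> X_set \<Phi> \<Delta> J"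
  shows "act w (std_face J) + C0 = act w C0"
proof
  fix \<beta>
  have w: "w \<in> W" "\<And>\<alpha>. \<alpha> \<in> J \<Longrightarrow> pos (w \<alpha>)" using assms X_set_iff by auto
  show "(act w (std_face J) + C0) \<beta> = act w C0 \<beta>"
  proof (cases "inv w \<beta> \<in> span J")
    case True
    have "C0 (w (inv w \<beta>)) = C0 (inv w \<beta>)"
      using C0_image[OF w(1) assms(1) w(2) True] .
    then show ?thesis
      using True assms(1) w(1) by (simp add: act_def std_eval[of J] plus_sign_def)
  next
    case False
    have "C0 (inv w \<beta>) = 0 \<longleftrightarrow> C0 \<beta> = 0"
      using w(1) W_root_iff[OF W_inv] by (simp add: C0_eq_0_iff)
    then show ?thesis
      using False assms(1) by (simp add: act_def std_eval[of J] plus_sign_def)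
  qed
qed

text \<open>The elements of \<open>X_set\<close> are the minimal coset representatives of the
  parabolic subgroup of \<open>J\<close>. The inverse map sends a face \<open>F\<close> to the
  \<open>w\<close> with \<open>F + C0 = act w C0\<close>, the projection of the base chamber onto
  \<open>F\<close>.\<close>

lemma X_set_std_bij:
  assumes J: "J \<subseteq> \<Delta>"
  shows "bij_betw (\<lambda>w. act w (std_face J)) (X_set \<Phi> \<Delta> J) (faces_of_type J)"
  unfolding bij_betw_def
proof
  have XW: "w \<in> W" if "w \<in> X_set \<Phi> \<Delta> J" for w using that J X_set_iff by auto
  show "inj_on (\<lambda>w. act w (std_face J)) (X_set \<Phi> \<Delta> J)"
    by (rule inj_onI) (metis J XW X_set_std_add_C0 act_C0_inj)
  show "(\<lambda>w. act w (std_face J)) ` X_set \<Phi> \<Delta> J = faces_of_type J"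
  proof
    show "(\<lambda>w. act w (std_face J)) ` X_set \<Phi> \<Delta> J \<subseteq> faces_of_type J" using XW by (auto simp: faces_of_type_def)
    show "faces_of_type J \<subseteq> (\<lambda>w. act w (std_face J)) ` X_set \<Phi> \<Delta> J"
    proof
      fix F assume F: "F \<in> faces_of_type J"
      then obtain u where u: "u \<in> W" "F = act u (std_face J)" by (auto simp: faces_of_type_def)
      have Ff: "F \<in> faces" using F faces_of_type_subset by auto
      then obtain w where w: "w \<in> W" "F + C0 = act w C0" using chamber_ex by blast
      let ?F = "act (inv w) F"
      obtain K where K: "K \<subseteq> \<Delta>" "?F = std_face K"
        using chamber_face[OF Ff w] by blast
      then have "std_face K \<in> faces_of_type J" using F act_faces_of_type_iff[OF W_inv[OF w(1)]] by metis
      then have KJ: "K = J" using std_face_in_faces_of_type_iff J K by blast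
      then have Fw: "F = act w (std_face J)" using K w by (metis act_inv(2))
      have "pos (w \<alpha>)" if "\<alpha> \<in> J" for \<alpha>
      proof -
        have "\<alpha> \<in> \<Delta>" using that J by auto
        have "F (w \<alpha>) = 0" using Fw w that J \<open>\<alpha> \<in> \<Delta>\<close> by (simp add: act_apply std_base_eq_0_iff)
        then have "C0 (w \<alpha>) = (F + C0) (w \<alpha>)" by (simp add: plus_sign_def)
        also have "\<dots> = C0 \<alpha>" using w by (simp add: act_apply)
        also have "\<dots> = Pos" using base_pos \<open>\<alpha> \<in> \<Delta>\<close> by (simp add: C0_eq_Pos_iff)
        finally show ?thesis by (simp add: C0_eq_Pos_iff)
      qed
      then have "w \<in> X_set \<Phi> \<Delta> J" using J w by (simp add: X_set_iff)
      then show "F \<in> (\<lambda>w. act w (std_face J)) ` X_set \<Phi> \<Delta> J" using Fw by blast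
    qed
  qed
qed

text \<open>This ties the exponent in \<open>M_elt\<close> to the support of a face:
  \<open>J\<close> is independent and lies between the zero set of the standard face and its
  span.\<close>

lemma dim_zero_set_type:
  assumes "J \<subseteq> \<Delta>" "F \<in> faces_of_type J"
  shows "dim (zero_set F) = card J"
proof -
  obtain w where w: "w \<in> W" "F = act w (std_face J)" using assms by (auto simp: faces_of_type_def)
  have "inj w" using w W_bij bij_is_inj by blast
  then have "dim (zero_set F) = dim (zero_set (std_face J))"
    unfolding w(2) zero_set_act[OF w(1)] using w W_linear
    by (intro dim_image_eq) (auto intro: inj_on_subset)
  also have "\<dots> = card J"
  proof -
    have "J \<subseteq> zero_set (std_face J)" using assms base_root span_superset by (auto simp: zero_set_std_face)
    moreover have "zero_set (std_face J) \<subseteq> span J" using assms by (auto simp: zero_set_std_face)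
    ultimately show ?thesis
      using basis_card_eq_dim independent_mono[OF base_independent assms(1)] by metis
  qed
  finally show ?thesis .
qed

lemma fiber_card_type: "F \<in> faces_of_type J \<Longrightarrow> fiber_card (zero_set F) = fiber_card (zero_set (std_face J))"
  by (auto simp: faces_of_type_def zero_set_act fiber_card_image)

subsection \<open>Counting factorizations of a face\<close>

text \<open>The left factor inherits no negative sign on positive roots, so it is a face of
  \<open>C0\<close>, and its type determines it. Thus in a factorization of a standard face only the
  right factor is free.\<close>

lemma std_add_eq_std:
  assumes "J \<subseteq> \<Delta>" "K \<subseteq> \<Delta>" "F \<in> faces_of_type J" "F + G = std_face K"
  shows "F = std_face J" "K \<subseteq> J"
proof -
  have FG: "F \<beta> + G \<beta> = std_face K \<beta>" for \<beta>
    using fun_cong[OF assms(4), of \<beta>] by simp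
  have "F \<beta> \<noteq> Neg" if "pos \<beta>" for \<beta>
  proof
    assume "F \<beta> = Neg"
    then have "std_face K \<beta> = Neg" using FG[of \<beta>] by (simp add: plus_sign_def)
    then show False using std_eval_pos[OF assms(2) that] by (simp split: if_splits)
  qed
  then obtain L where L: "L \<subseteq> \<Delta>" "F = std_face L"
    using face_of_C0 assms faces_of_type_subset by blast
  then show F: "F = std_face J" using std_face_in_faces_of_type_iff assms by blast
  show "K \<subseteq> J"
  proof
    fix \<alpha> assume a: "\<alpha> \<in> K"
    then have "\<alpha> \<in> \<Delta>" using assms by auto
    then show "\<alpha> \<in> J" using FG[of \<alpha>] a F std_base_eq_0_iff sign_add_eq_0_iff by metis
  qed
qed

lemma span_image_iff:
  assumes "w \<in> W"
  shows "w \<beta> \<in> span (w ` K) \<longleftrightarrow> \<beta> \<in> span K"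
  using assms by (simp add: linear_span_image W_linear inj_image_mem_iff W_bij bij_is_inj)

text \<open>Simple roots are the indecomposable positive ones. Pulling the expansion of
  \<open>w \<alpha>\<close> over \<open>L\<close> back by \<open>w\<close> writes
  \<open>\<alpha>\<close> as a nonnegative combination of positive roots; comparing coordinates,
  each root that really occurs is \<open>\<alpha>\<close>.\<close>

lemma base_image_subset:
  assumes w: "w \<in> W" and K: "K \<subseteq> \<Delta>" and L: "L \<subseteq> \<Delta>"
    and im: "w ` (\<Phi> \<inter> span K) = \<Phi> \<inter> span L"
    and pos: "\<And>\<beta>. \<beta> \<in> \<Phi> \<inter> span K \<Longrightarrow> pos (w \<beta>) \<longleftrightarrow> pos \<beta>"
  shows "w ` K \<subseteq> L"
proof (rule image_subsetI)
  fix \<alpha> assume a: "\<alpha> \<in> K"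
  have aD: "\<alpha> \<in> \<Delta>" and aS: "\<alpha> \<in> \<Phi> \<inter> span K" using a K base_root span_base by auto
  have x: "w \<alpha> \<in> \<Phi>" "w \<alpha> \<in> span L" "pos (w \<alpha>)"
    using aS im pos base_pos[OF aD] by auto
  have vpos: "pos (inv w \<gamma>)" if g: "\<gamma> \<in> L" for \<gamma>
  proof -
    have "\<gamma> \<in> \<Phi> \<inter> span L" using g L base_root span_base by auto
    then obtain \<gamma>' where "\<gamma>' \<in> \<Phi> \<inter> span K" "\<gamma> = w \<gamma>'" using im by blast
    then show ?thesis using pos[of \<gamma>'] base_pos[of \<gamma>] g L w by auto
  qed
  have c0: "coweight \<gamma> \<bullet> w \<alpha> \<ge> 0" if "\<gamma> \<in> \<Delta>" for \<gamma> using x that by (simp add: pos_iff)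
  have "w \<alpha> = (\<Sum>\<gamma>\<in>\<Delta>. (coweight \<gamma> \<bullet> w \<alpha>) *\<^sub>R \<gamma>)" using root_expand x by blast
  also have "\<dots> = (\<Sum>\<gamma>\<in>L. (coweight \<gamma> \<bullet> w \<alpha>) *\<^sub>R \<gamma>)"
    using L x root_span span_subset_iff[OF L] by (intro sum.mono_neutral_right) auto
  finally have wa: "w \<alpha> = (\<Sum>\<gamma>\<in>L. (coweight \<gamma> \<bullet> w \<alpha>) *\<^sub>R \<gamma>)" .
  have lin: "linear (inv w)" using w W_inv W_linear by blast
  have "\<alpha> = inv w (w \<alpha>)" using w by simp
  also have "\<dots> = inv w (\<Sum>\<gamma>\<in>L. (coweight \<gamma> \<bullet> w \<alpha>) *\<^sub>R \<gamma>)" using wa by simp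
  also have "\<dots> = (\<Sum>\<gamma>\<in>L. (coweight \<gamma> \<bullet> w \<alpha>) *\<^sub>R inv w \<gamma>)"
    using lin by (simp add: linear_sum linear_scale)
  finally have al: "\<alpha> = (\<Sum>\<gamma>\<in>L. (coweight \<gamma> \<bullet> w \<alpha>) *\<^sub>R inv w \<gamma>)" .
  have "w \<alpha> \<noteq> 0" using x root_nonzero by blast
  then obtain \<gamma> where g: "\<gamma> \<in> L" "coweight \<gamma> \<bullet> w \<alpha> \<noteq> 0"
    using wa sum.neutral[of L "\<lambda>\<gamma>. (coweight \<gamma> \<bullet> w \<alpha>) *\<^sub>R \<gamma>"] by (metis scaleR_eq_0_iff)
  have "inv w \<gamma> = \<alpha>"
  proof (rule pos_multiple_base[OF vpos[OF g(1)] aD])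
    fix \<delta> assume d: "\<delta> \<in> \<Delta>" "\<delta> \<noteq> \<alpha>"
    have "0 = coweight \<delta> \<bullet> \<alpha>" using d aD by (simp add: coweight_inner)
    also have "\<dots> = coweight \<delta> \<bullet> (\<Sum>\<gamma>\<in>L. (coweight \<gamma> \<bullet> w \<alpha>) *\<^sub>R inv w \<gamma>)" using al by simp
    also have "\<dots> = (\<Sum>\<gamma>\<in>L. (coweight \<gamma> \<bullet> w \<alpha>) * (coweight \<delta> \<bullet> inv w \<gamma>))"
      by (simp add: inner_sum_right)
    finally have "\<forall>\<gamma>\<in>L. (coweight \<gamma> \<bullet> w \<alpha>) * (coweight \<delta> \<bullet> inv w \<gamma>) = 0"
      using sum_nonneg_eq_0_iff[of L "\<lambda>\<gamma>. (coweight \<gamma> \<bullet> w \<alpha>) * (coweight \<delta> \<bullet> inv w \<gamma>)"]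
        finite_subset[OF L finite_base] c0 L vpos d(1)
      by (auto simp: pos_iff subset_eq)
    then show "coweight \<delta> \<bullet> inv w \<gamma> = 0" using g by auto
  qed
  then show "w \<alpha> \<in> L" using g w by auto
qed

lemma base_image_eq:
  assumes w: "w \<in> W" and K: "K \<subseteq> \<Delta>" and L: "L \<subseteq> \<Delta>"
    and im: "w ` (\<Phi> \<inter> span K) = \<Phi> \<inter> span L"
    and pos: "\<And>\<beta>. \<beta> \<in> \<Phi> \<inter> span K \<Longrightarrow> pos (w \<beta>) \<longleftrightarrow> pos \<beta>"
  shows "w ` K = L"
proof
  show "w ` K \<subseteq> L" using base_image_subset assms by blast
  have "inv w ` L \<subseteq> K"
  proof (rule base_image_subset[OF W_inv[OF w] L K])
    show im': "inv w ` (\<Phi> \<inter> span L) = \<Phi> \<inter> span K"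
      unfolding im[symmetric] using w by (simp add: image_image)
    show "pos (inv w \<beta>) \<longleftrightarrow> pos \<beta>" if "\<beta> \<in> \<Phi> \<inter> span L" for \<beta>
      using pos[of "inv w \<beta>"] that im' w by auto
  qed
  then have "w ` inv w ` L \<subseteq> w ` K" by blast
  then show "L \<subseteq> w ` K" using w by (simp add: image_image)
qed

lemma act_inv_std_eval:
  assumes "w \<in> W" "w ` K \<subseteq> \<Delta>"
  shows "act (inv w) (std_face (w ` K)) \<beta> = (if \<beta> \<in> span K then 0 else C0 (w \<beta>))"
  using assms by (simp add: act_def inv_inv_eq W_bij std_eval span_image_iff)

lemma C0_W_eq_0_iff: "w \<in> W \<Longrightarrow> C0 (w \<beta>) = 0 \<longleftrightarrow> \<beta> \<notin> \<Phi>"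
  by (simp add: C0_eq_0_iff W_root_iff)

text \<open>A face \<open>G\<close> with the support of the standard face of type \<open>K\<close> is \<open>w\<inverse>\<close> applied to a standard
  face, where \<open>G + C0 = w\<inverse> C0\<close>. Since \<open>w\<close> maps the positive roots in the span of \<open>K\<close> onto those in
  the span of the new type, it maps \<open>K\<close> itself onto that type.\<close>

lemma factor_bij:
  assumes J: "J \<subseteq> \<Delta>" and KJ: "K \<subseteq> J"
  shows "bij_betw (\<lambda>w. act (inv w) (std_face (w ` K))) {w \<in> X_set \<Phi> \<Delta> J. w ` K \<subseteq> \<Delta>}
    {G \<in> faces. zero_set G \<subseteq> zero_set (std_face J) \<and> std_face J + G = std_face K}"
    (is "bij_betw ?g ?A ?B")
  unfolding bij_betw_def
proof
  have K: "K \<subseteq> \<Delta>" using J KJ by auto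
  have A: "w \<in> W" "\<And>\<alpha>. \<alpha> \<in> J \<Longrightarrow> pos (w \<alpha>)" "w ` K \<subseteq> \<Delta>" if "w \<in> ?A" for w
    using that X_set_iff[OF J] by auto
  have spanKJ: "span K \<subseteq> span J" using KJ span_mono by blast
  show "inj_on ?g ?A"
  proof (rule inj_onI)
    fix w w' assume w: "w \<in> ?A" "w' \<in> ?A" "?g w = ?g w'"
    \<comment> \<open>Multiplying by the base chamber recovers \<open>w\<close> from its image,
      since the group acts freely on chambers.\<close>
    have *: "?g w + C0 = act (inv w) C0" if "w \<in> ?A" for w
    proof
      fix \<beta>
      have "C0 (w \<beta>) = C0 \<beta>" if "\<beta> \<in> span K"
        using C0_image[OF A(1)[OF \<open>w \<in> ?A\<close>] J A(2)[OF \<open>w \<in> ?A\<close>]] that spanKJ by blast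
      moreover have "C0 (w \<beta>) = 0 \<longleftrightarrow> C0 \<beta> = 0"
        using C0_W_eq_0_iff[OF A(1)[OF that]] C0_eq_0_iff by blast
      ultimately show "(?g w + C0) \<beta> = act (inv w) C0 \<beta>"
        using A[OF that] by (auto simp: act_inv_std_eval plus_sign_def)
          (simp_all add: act_def inv_inv_eq W_bij)
    qed
    have "inv w = inv w'"
      using *[OF w(1)] *[OF w(2)] w(3) A(1)[OF w(1)] A(1)[OF w(2)] act_C0_inj W_inv by metis
    then have "inv (inv w) = inv (inv w')" by simp
    then show "w = w'" using A(1)[OF w(1)] A(1)[OF w(2)] by (simp add: inv_inv_eq W_bij)
  qed
  show "?g ` ?A = ?B"
  proof
    show "?g ` ?A \<subseteq> ?B"
    proof (rule image_subsetI)
      fix w assume w: "w \<in> ?A"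
      have "zero_set (?g w) \<subseteq> zero_set (std_face J)"
      proof
        fix \<beta> assume "\<beta> \<in> zero_set (?g w)"
        then have "\<beta> \<in> \<Phi>" "\<beta> \<in> span K"
          using act_inv_std_eval[OF A(1,3)[OF w], of \<beta>] C0_W_eq_0_iff[OF A(1)[OF w], of \<beta>]
          by (auto simp: zero_set_def split: if_splits)
        then show "\<beta> \<in> zero_set (std_face J)" using spanKJ by (auto simp: zero_set_std_face J)
      qed
      moreover have "std_face J + ?g w = std_face K"
      proof
        fix \<beta>
        have "C0 (w \<beta>) = C0 \<beta>" if "\<beta> \<in> span J"
          using C0_image[OF A(1)[OF w] J A(2)[OF w]] that by blast
        moreover have "C0 (w \<beta>) = 0 \<longleftrightarrow> C0 \<beta> = 0"
          using C0_W_eq_0_iff[OF A(1)[OF w]] C0_eq_0_iff by blast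
        ultimately show "(std_face J + ?g w) \<beta> = std_face K \<beta>"
          using A[OF w] spanKJ
          by (cases "\<beta> \<in> span J"; cases "\<beta> \<in> span K")
            (auto simp: act_inv_std_eval plus_sign_def std_eval[OF J] std_eval[OF K])
      qed
      moreover have "?g w \<in> faces" using act_faces W_inv A(1)[OF w] by simp
      ultimately show "?g w \<in> ?B" by simp
    qed
    show "?B \<subseteq> ?g ` ?A"
    proof
      fix G assume "G \<in> ?B"
      then have G: "G \<in> faces" "zero_set G \<subseteq> zero_set (std_face J)" "std_face J + G = std_face K" by auto
      have "zero_set (std_face K) = zero_set (std_face J) \<inter> zero_set G" using G z_add[of "std_face J" G] by simp
      then have zG: "zero_set G = \<Phi> \<inter> span K" using G zero_set_std_face[OF K] by auto
      obtain v where v: "v \<in> W" "G + C0 = act v C0" using chamber_ex G by blast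
      define w where "w = inv v"
      have w: "w \<in> W" "v = inv w" using v W_inv by (auto simp: w_def inv_inv_eq W_bij)
      obtain L where L: "L \<subseteq> \<Delta>" "act w G = std_face L"
        using chamber_face[OF G(1) v] by (auto simp: w_def)
      have GC: "G \<beta> + C0 \<beta> = C0 (w \<beta>)" for \<beta>
        using fun_cong[OF v(2), of \<beta>] by (simp add: act_def w_def)
      have "w ` (\<Phi> \<inter> span K) = \<Phi> \<inter> span L"
        using zero_set_act[OF w(1), of G] L zero_set_std_face zG by simp
      moreover have "pos (w \<beta>) \<longleftrightarrow> pos \<beta>" if "\<beta> \<in> \<Phi> \<inter> span K" for \<beta>
      proof -
        have "G \<beta> = 0" using that zG by (auto simp: zero_set_def)
        then show ?thesis using GC[of \<beta>] by (simp add: plus_sign_def flip: C0_eq_Pos_iff)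
      qed
      ultimately have wK: "w ` K = L" by (rule base_image_eq[OF w(1) K L(1)])
      have "pos (w \<alpha>)" if a: "\<alpha> \<in> J" for \<alpha>
      proof (cases "\<alpha> \<in> K")
        case True
        then show ?thesis using wK L base_pos by auto
      next
        case False
        have aD: "\<alpha> \<in> \<Delta>" using a J by auto
        \<comment> \<open>The left factor vanishes at \<open>\<alpha>\<close> and the product does
          not, so the sign must come from \<open>G\<close>.\<close>
        have "std_face J \<alpha> = 0" "std_face K \<alpha> \<noteq> 0" using a aD False std_base_eq_0_iff by auto
        then have "G \<alpha> = std_face K \<alpha>" "std_face K \<alpha> = Pos"
          using fun_cong[OF G(3), of \<alpha>] std_eval_pos[OF K base_pos[OF aD]]
          by (auto simp: plus_sign_def split: if_splits)
        then show ?thesis using GC[of \<alpha>] by (simp add: plus_sign_def flip: C0_eq_Pos_iff)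
      qed
      then have "w \<in> ?A" using w X_set_iff[OF J] wK L by auto
      moreover have "G = ?g w" using wK L w by (metis act_inv(1))
      ultimately show "G \<in> ?g ` ?A" by blast
    qed
  qed
qed

definition factorizations :: "'a set \<Rightarrow> ('a \<Rightarrow> sign) \<Rightarrow> (('a \<Rightarrow> sign) \<times> ('a \<Rightarrow> sign)) set" where
  "factorizations J H = {(F, G). F \<in> faces_of_type J \<and> G \<in> faces \<and> zero_set G \<subseteq> zero_set F \<and> F + G = H}"

lemma card_factorizations_std:
  assumes "J \<subseteq> \<Delta>" "K \<subseteq> \<Delta>"
  shows "card (factorizations J (std_face K)) =
    (if K \<subseteq> J then card {w \<in> X_set \<Phi> \<Delta> J. w ` K \<subseteq> \<Delta>} else 0)"
proof (cases "K \<subseteq> J")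
  case True
  let ?B = "{G \<in> faces. zero_set G \<subseteq> zero_set (std_face J) \<and> std_face J + G = std_face K}"
  have "factorizations J (std_face K) = Pair (std_face J) ` ?B"
    unfolding factorizations_def using std_add_eq_std(1)[OF assms] std_face_in_faces_of_type by (auto simp: image_iff)
  then have "card (factorizations J (std_face K)) = card ?B"
    by (simp add: card_image inj_on_def)
  also have "\<dots> = card {w \<in> X_set \<Phi> \<Delta> J. w ` K \<subseteq> \<Delta>}"
    using bij_betw_same_card[OF factor_bij[OF assms(1) True]] by simp
  finally show ?thesis using True by simp
next
  case False
  then have "factorizations J (std_face K) = {}"
    unfolding factorizations_def using std_add_eq_std(2)[OF assms] by auto
  then show ?thesis using False by simp
qed

text \<open>The action moves both factors at once and preserves the type of the first, so it
  suffices to count for standard faces.\<close>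

lemma card_factorizations_act:
  assumes "w \<in> W"
  shows "card (factorizations J (act w H)) = card (factorizations J H)"
proof -
  have *: "map_prod (act u) (act u) ` factorizations J H \<subseteq> factorizations J (act u H)"
    if "u \<in> W" for u H
    using that by (auto simp: factorizations_def act_faces_of_type_iff act_faces zero_set_act act_add) blast
  have "bij_betw (map_prod (act w) (act w)) (factorizations J H) (factorizations J (act w H))"
  proof (rule bij_betwI[of _ _ _ "map_prod (act (inv w)) (act (inv w))"])
    show "map_prod (act w) (act w) \<in> factorizations J H \<rightarrow> factorizations J (act w H)"
      using *[OF assms, of H] by blast
    show "map_prod (act (inv w)) (act (inv w)) \<in> factorizations J (act w H) \<rightarrow> factorizations J H"
      using *[OF W_inv[OF assms], of "act w H"] assms by auto
  qed (use assms in auto)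
  then show ?thesis by (simp add: bij_betw_same_card)
qed

lemma card_factorizations:
  assumes "J \<subseteq> \<Delta>" "K \<subseteq> \<Delta>" "H \<in> faces_of_type K"
  shows "card (factorizations J H) =
    (if K \<subseteq> J then card {w \<in> X_set \<Phi> \<Delta> J. w ` K \<subseteq> \<Delta>} else 0)"
proof -
  obtain w where "w \<in> W" "H = act w (std_face K)" using assms by (auto simp: faces_of_type_def)
  then show ?thesis using card_factorizations_act card_factorizations_std assms by simp
qed

subsection \<open>Descent elements in the face algebra\<close>

abbreviation class_card :: "'a set \<Rightarrow> real" where
  "class_card J \<equiv> real (card (class_of \<Phi> \<Delta> J))"

lemma equiv_subset_rel: "equiv (Pow \<Delta>) (subset_rel \<Phi> \<Delta>)"
proof (rule equivI)
  show "subset_rel \<Phi> \<Delta> \<subseteq> Pow \<Delta> \<times> Pow \<Delta>" by (auto simp: subset_rel_def)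
  show "refl_on (Pow \<Delta>) (subset_rel \<Phi> \<Delta>)"
    using refl_group.one[of \<Phi>] by (auto simp: refl_on_def subset_rel_def intro!: bexI[of _ id])
  show "sym (subset_rel \<Phi> \<Delta>)"
  proof (rule symI)
    fix J K assume "(J, K) \<in> subset_rel \<Phi> \<Delta>"
    then obtain w where w: "J \<subseteq> \<Delta>" "K \<subseteq> \<Delta>" "w \<in> W" "w ` J = K" by (auto simp: subset_rel_def)
    then have "inv w ` K = J" by (auto simp: image_image)
    then show "(K, J) \<in> subset_rel \<Phi> \<Delta>" using w W_inv by (auto simp: subset_rel_def)
  qed
  show "trans (subset_rel \<Phi> \<Delta>)"
  proof (rule transI)
    fix J K L assume "(J, K) \<in> subset_rel \<Phi> \<Delta>" "(K, L) \<in> subset_rel \<Phi> \<Delta>"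
    then obtain w v where w: "J \<subseteq> \<Delta>" "L \<subseteq> \<Delta>" "w \<in> W" "w ` J = K" "v \<in> W" "v ` K = L"
      by (auto simp: subset_rel_def)
    then have "(v \<circ> w) ` J = L" unfolding image_comp[symmetric] by simp
    then show "(J, L) \<in> subset_rel \<Phi> \<Delta>"
      using w W_comp[of v w] unfolding subset_rel_def by blast
  qed
qed

lemma class_of_subset: "class_of \<Phi> \<Delta> J \<subseteq> Pow \<Delta>"
  by (auto simp: class_of_def subset_rel_def)

lemma class_of_self: "J \<subseteq> \<Delta> \<Longrightarrow> J \<in> class_of \<Phi> \<Delta> J"
  using equiv_class_self[OF equiv_subset_rel] by (simp add: class_of_def)

lemma class_card_pos: "J \<subseteq> \<Delta> \<Longrightarrow> class_card J > 0"
  using class_of_self finite_subset[OF class_of_subset] by (auto simp: card_gt_0_iff)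

lemma class_of_eq_iff:
  "J \<subseteq> \<Delta> \<Longrightarrow> K \<subseteq> \<Delta> \<Longrightarrow> class_of \<Phi> \<Delta> J = class_of \<Phi> \<Delta> K \<longleftrightarrow> J \<in> class_of \<Phi> \<Delta> K"
  using eq_equiv_class_iff[OF equiv_subset_rel, of K J] by (auto simp: class_of_def)

lemma card_class_of:
  assumes "J \<in> class_of \<Phi> \<Delta> K"
  shows "card J = card K"
proof -
  obtain w where "w \<in> W" "w ` K = J" using assms by (auto simp: class_of_def subset_rel_def)
  then show ?thesis using W_bij by (metis bij_is_inj card_image inj_on_subset top_greatest)
qed

lemma class_rank_class_of: "K \<subseteq> \<Delta> \<Longrightarrow> class_rank (class_of \<Phi> \<Delta> K) = card K"
  unfolding class_rank_def using class_of_self by (metis card_class_of someI_ex)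

text \<open>Class size and rank are constant on a class, so the sum over the quotient becomes a sum
  over subsets that matches the indexing of faces by type.\<close>

lemma sum_classes:
  fixes f :: "'a set \<Rightarrow> real" and x :: real
  shows "(\<Sum>C\<in>classes \<Phi> \<Delta>. (\<Sum>J\<in>C. f J) / (card C * x ^ class_rank C)) =
    (\<Sum>J\<in>Pow \<Delta>. f J / (class_card J * x ^ card J))"
proof -
  have cl: "classes \<Phi> \<Delta> = class_of \<Phi> \<Delta> ` Pow \<Delta>"
    by (auto simp: classes_def class_of_def quotient_def)
  have "(\<Sum>J\<in>Pow \<Delta>. f J / (class_card J * x ^ card J)) =
    (\<Sum>C\<in>class_of \<Phi> \<Delta> ` Pow \<Delta>. \<Sum>J\<in>{J \<in> Pow \<Delta>. class_of \<Phi> \<Delta> J = C}. f J / (class_card J * x ^ card J))"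
    by (rule sum.image_gen) simp
  also have "\<dots> = (\<Sum>C\<in>class_of \<Phi> \<Delta> ` Pow \<Delta>. (\<Sum>J\<in>C. f J) / (card C * x ^ class_rank C))"
  proof (intro sum.cong refl)
    fix C assume "C \<in> class_of \<Phi> \<Delta> ` Pow \<Delta>"
    then obtain K where K: "K \<subseteq> \<Delta>" "C = class_of \<Phi> \<Delta> K" by auto
    have C_iff: "J \<in> C \<longleftrightarrow> J \<in> Pow \<Delta> \<and> class_of \<Phi> \<Delta> J = C" for J
      using K(1) class_of_subset[of K] class_of_eq_iff[of J K] unfolding K(2) by blast
    then have members: "{J \<in> Pow \<Delta>. class_of \<Phi> \<Delta> J = C} = C"
      by blast
    have summand: "f J / (class_card J * x ^ card J) = f J / (card C * x ^ class_rank C)"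
      if "J \<in> C" for J
    proof -
      have "J \<subseteq> \<Delta>" "class_of \<Phi> \<Delta> J = C" using that C_iff by blast+
      then show ?thesis using class_rank_class_of by auto
    qed
    show "(\<Sum>J\<in>{J \<in> Pow \<Delta>. class_of \<Phi> \<Delta> J = C}. f J / (class_card J * x ^ card J)) =
      (\<Sum>J\<in>C. f J) / (card C * x ^ class_rank C)"
      unfolding members sum_divide_distrib by (intro sum.cong refl summand)
  qed
  finally show ?thesis using cl by simp
qed

lemma mu_diag: "J \<subseteq> \<Delta> \<Longrightarrow> mu \<Phi> \<Delta> J J \<noteq> 0"
proof -
  assume J: "J \<subseteq> \<Delta>"
  have "id \<in> X_set \<Phi> \<Delta> J"
    using J base_pos refl_group.one by (simp add: X_set_iff subset_eq)
  then have "id \<in> {w \<in> X_set \<Phi> \<Delta> J. w ` J \<subseteq> \<Delta>}"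
    using J by simp
  moreover have "finite {w \<in> X_set \<Phi> \<Delta> J. w ` J \<subseteq> \<Delta>}"
    by (rule finite_subset[OF _ W_finite]) (auto simp: X_set_def)
  ultimately have "card {w \<in> X_set \<Phi> \<Delta> J. w ` J \<subseteq> \<Delta>} > 0"
    unfolding card_gt_0_iff by blast
  then show ?thesis using class_card_pos[OF J] by (auto simp: mu_def)
qed

lemma beta_mu:
  "J \<subseteq> \<Delta> \<Longrightarrow> L \<subseteq> \<Delta> \<Longrightarrow> (\<Sum>K\<in>Pow \<Delta>. beta \<Phi> \<Delta> J K * mu \<Phi> \<Delta> K L) = (if J = L then 1 else 0)"
  and beta_triangular: "J \<subseteq> \<Delta> \<Longrightarrow> \<not> K \<subseteq> J \<Longrightarrow> beta \<Phi> \<Delta> J K = 0"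
proof -
  have tri: "mu \<Phi> \<Delta> J K = 0" if "J \<subseteq> \<Delta>" "\<not> K \<subseteq> J" for J K using that by (simp add: mu_def)
  show "J \<subseteq> \<Delta> \<Longrightarrow> L \<subseteq> \<Delta> \<Longrightarrow> (\<Sum>K\<in>Pow \<Delta>. beta \<Phi> \<Delta> J K * mu \<Phi> \<Delta> K L) = (if J = L then 1 else 0)"
    unfolding beta_def by (rule triangular_matrix_inv_on(1)[OF finite_base tri mu_diag])
  show "J \<subseteq> \<Delta> \<Longrightarrow> \<not> K \<subseteq> J \<Longrightarrow> beta \<Phi> \<Delta> J K = 0"
    unfolding beta_def by (rule triangular_matrix_inv_on(2)[OF finite_base tri mu_diag])
qed

abbreviation type_fiber_card :: "'a set \<Rightarrow> real" where
  "type_fiber_card K \<equiv> fiber_card (zero_set (std_face K))"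

definition type_sum :: "'a set \<Rightarrow> ('a \<Rightarrow> sign) \<Rightarrow>\<^sub>0 real" where
  "type_sum J = (\<Sum>F\<in>faces_of_type J. point F)"

definition type_pidem :: "'a set \<Rightarrow> ('a \<Rightarrow> sign) \<Rightarrow>\<^sub>0 real" where
  "type_pidem J = (\<Sum>F\<in>faces_of_type J. pidem F)"

lemma sum_faces_by_type:
  fixes g :: "('a \<Rightarrow> sign) \<Rightarrow> ('a \<Rightarrow> sign) \<Rightarrow>\<^sub>0 real"
  shows "(\<Sum>F\<in>faces. g F) = (\<Sum>J\<in>Pow \<Delta>. \<Sum>F\<in>faces_of_type J. g F)"
  unfolding faces_eq_Union_faces_of_type using faces_of_type_disjoint by (intro sum.UNION_disjoint) auto

text \<open>The coefficient of \<open>pidem H\<close> is a number of factorizations, which depends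
  only on the type \<open>K\<close> of \<open>H\<close> and is the numerator of \<open>mu\<close>.
  The factor \<open>class_card K\<close> restores the denominator of \<open>mu\<close>.\<close>

lemma type_sum_eq:
  assumes J: "J \<subseteq> \<Delta>"
  shows "type_sum J =
    (\<Sum>K\<in>Pow \<Delta>. scalar (mu \<Phi> \<Delta> J K) * (scalar (class_card K / type_fiber_card K) * type_pidem K))"
proof -
  have "type_sum J = (\<Sum>H\<in>faces.
      scalar (real (card (factorizations J H)) / fiber_card (zero_set H)) * pidem H)"
    unfolding type_sum_def factorizations_def by (rule sum_point_eq_sum_pidem[OF faces_of_type_subset])
  also have "\<dots> = (\<Sum>K\<in>Pow \<Delta>. \<Sum>H\<in>faces_of_type K.
      scalar (real (card (factorizations J H)) / fiber_card (zero_set H)) * pidem H)"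
    by (rule sum_faces_by_type)
  also have "\<dots> = (\<Sum>K\<in>Pow \<Delta>. scalar (mu \<Phi> \<Delta> J K) *
      (scalar (class_card K / type_fiber_card K) * type_pidem K))"
  proof (intro sum.cong refl)
    fix K assume "K \<in> Pow \<Delta>"
    then have K: "K \<subseteq> \<Delta>" by simp
    have "(\<Sum>H\<in>faces_of_type K. scalar (real (card (factorizations J H)) / fiber_card (zero_set H)) * pidem H) =
      (\<Sum>H\<in>faces_of_type K. scalar (mu \<Phi> \<Delta> J K * (class_card K / type_fiber_card K)) * pidem H)"
    proof (intro sum.cong refl)
      fix H assume H: "H \<in> faces_of_type K"
      have "real (card (factorizations J H)) = mu \<Phi> \<Delta> J K * class_card K"
        using card_factorizations[OF J K H] class_card_pos[OF K] by (simp add: mu_def)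
      then show "scalar (real (card (factorizations J H)) / fiber_card (zero_set H)) * pidem H =
        scalar (mu \<Phi> \<Delta> J K * (class_card K / type_fiber_card K)) * pidem H"
        by (simp add: fiber_card_type[OF H])
    qed
    then show "(\<Sum>H\<in>faces_of_type K. scalar (real (card (factorizations J H)) / fiber_card (zero_set H)) * pidem H) =
      scalar (mu \<Phi> \<Delta> J K) * (scalar (class_card K / type_fiber_card K) * type_pidem K)"
      by (simp only: type_pidem_def scalar_scalar sum_distrib_left)
  qed
  finally show ?thesis .
qed

lemma type_pidem_eq:
  assumes J: "J \<subseteq> \<Delta>"
  shows "scalar (class_card J / type_fiber_card J) * type_pidem J =
    (\<Sum>K\<in>Pow \<Delta>. scalar (beta \<Phi> \<Delta> J K) * type_sum K)"
proof -
  let ?p = "\<lambda>L. scalar (class_card L / type_fiber_card L) * type_pidem L"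
  have "(\<Sum>K\<in>Pow \<Delta>. scalar (beta \<Phi> \<Delta> J K) * type_sum K) =
    (\<Sum>K\<in>Pow \<Delta>. \<Sum>L\<in>Pow \<Delta>. scalar (beta \<Phi> \<Delta> J K * mu \<Phi> \<Delta> K L) * ?p L)"
  proof (intro sum.cong refl)
    fix K assume "K \<in> Pow \<Delta>"
    then show "scalar (beta \<Phi> \<Delta> J K) * type_sum K =
      (\<Sum>L\<in>Pow \<Delta>. scalar (beta \<Phi> \<Delta> J K * mu \<Phi> \<Delta> K L) * ?p L)"
      by (simp only: type_sum_eq Pow_iff sum_distrib_left scalar_scalar mult.assoc)
  qed
  also have "\<dots> = (\<Sum>L\<in>Pow \<Delta>. \<Sum>K\<in>Pow \<Delta>. scalar (beta \<Phi> \<Delta> J K * mu \<Phi> \<Delta> K L) * ?p L)"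
    by (rule sum.swap)
  also have "\<dots> = (\<Sum>L\<in>Pow \<Delta>. if J = L then ?p L else 0)"
  proof (intro sum.cong refl)
    fix L assume "L \<in> Pow \<Delta>"
    then have eq: "(\<Sum>K\<in>Pow \<Delta>. scalar (beta \<Phi> \<Delta> J K * mu \<Phi> \<Delta> K L)) = scalar (if J = L then 1 else 0)"
      using beta_mu[OF J, of L] by (simp add: scalar_sum[symmetric])
    show "(\<Sum>K\<in>Pow \<Delta>. scalar (beta \<Phi> \<Delta> J K * mu \<Phi> \<Delta> K L) * ?p L) = (if J = L then ?p L else 0)"
      unfolding sum_distrib_right[symmetric] eq by simp
  qed
  also have "\<dots> = ?p J" using J by simp
  finally show ?thesis by simp
qed

text \<open>Group the pieces by type. The factor \<open>1 / class_card J\<close>, wanted for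
  \<open>e_elt\<close>, is introduced here against the \<open>class_card J\<close> carried by
  \<open>type_pidem_eq\<close>.\<close>

lemma diag_eq_sum_type_sum:
  "diag (\<lambda>X. 1 / x ^ dim X) = (\<Sum>J\<in>Pow \<Delta>. scalar (1 / (class_card J * x ^ card J)) *
    (\<Sum>K\<in>Pow \<Delta>. scalar (beta \<Phi> \<Delta> J K) * type_sum K))"
proof -
  have "diag (\<lambda>X. 1 / x ^ dim X) =
    (\<Sum>J\<in>Pow \<Delta>. \<Sum>G\<in>faces_of_type J. scalar (1 / x ^ dim (zero_set G) / fiber_card (zero_set G)) * pidem G)"
    by (simp only: diag_eq_sum_pidem sum_faces_by_type)
  also have "\<dots> = (\<Sum>J\<in>Pow \<Delta>. scalar (1 / (class_card J * x ^ card J)) *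
    (\<Sum>K\<in>Pow \<Delta>. scalar (beta \<Phi> \<Delta> J K) * type_sum K))"
  proof (intro sum.cong refl)
    fix J assume "J \<in> Pow \<Delta>"
    then have J: "J \<subseteq> \<Delta>" by simp
    have "(\<Sum>G\<in>faces_of_type J. scalar (1 / x ^ dim (zero_set G) / fiber_card (zero_set G)) * pidem G) =
      (\<Sum>G\<in>faces_of_type J. scalar (1 / (class_card J * x ^ card J) * (class_card J / type_fiber_card J)) * pidem G)"
      using class_card_pos[OF J] by (intro sum.cong refl) (simp add: dim_zero_set_type[OF J] fiber_card_type)
    also have "\<dots> = scalar (1 / (class_card J * x ^ card J)) *
       (scalar (class_card J / type_fiber_card J) * type_pidem J)"
      by (simp only: type_pidem_def scalar_scalar sum_distrib_left)
    finally show "(\<Sum>G\<in>faces_of_type J. scalar (1 / x ^ dim (zero_set G) / fiber_card (zero_set G)) * pidem G) =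
      scalar (1 / (class_card J * x ^ card J)) * (\<Sum>K\<in>Pow \<Delta>. scalar (beta \<Phi> \<Delta> J K) * type_sum K)"
      by (simp only: type_pidem_eq[OF J])
  qed
  finally show ?thesis .
qed

subsection \<open>From the face algebra to the group algebra\<close>

text \<open>The embedding of the group algebra into the face algebra that sends \<open>w\<close> to
  the chamber \<open>act w C0\<close>.\<close>

definition chamber_sum :: "(('a \<Rightarrow> 'a) \<Rightarrow> real) \<Rightarrow> ('a \<Rightarrow> sign) \<Rightarrow>\<^sub>0 real" where
  "chamber_sum f = (\<Sum>w\<in>W. scalar (f w) * point (act w C0))"

text \<open>Elements of the face algebra multiply chambers from the left. For a \<open>W\<close>-invariant element this is
  right multiplication in the group algebra, so products are represented in reverse order.\<close>

definition represents :: "(('a \<Rightarrow> sign) \<Rightarrow>\<^sub>0 real) \<Rightarrow> (('a \<Rightarrow> 'a) \<Rightarrow> real) \<Rightarrow> bool" where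
  "represents A f \<longleftrightarrow>
    (\<forall>u\<in>W. A * point (act u C0) = (\<Sum>w\<in>W. scalar (f w) * point (act (u \<circ> w) C0)))"

lemma represents_scalar: "represents A f \<Longrightarrow> represents (scalar c * A) (\<lambda>w. c * f w)"
  by (simp add: represents_def mult.assoc sum_distrib_left scalar_scalar del: comp_apply)

lemma represents_sum:
  assumes "finite I" "\<And>i. i \<in> I \<Longrightarrow> represents (A i) (f i)"
  shows "represents (\<Sum>i\<in>I. A i) (\<lambda>w. \<Sum>i\<in>I. f i w)"
  unfolding represents_def
proof
  fix u assume u: "u \<in> W"
  have "(\<Sum>i\<in>I. A i) * point (act u C0) = (\<Sum>i\<in>I. \<Sum>w\<in>W. scalar (f i w) * point (act (u \<circ> w) C0))"
    unfolding sum_distrib_right using assms u by (intro sum.cong refl) (auto simp: represents_def)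
  also have "\<dots> = (\<Sum>w\<in>W. \<Sum>i\<in>I. scalar (f i w) * point (act (u \<circ> w) C0))"
    by (rule sum.swap)
  finally show "(\<Sum>i\<in>I. A i) * point (act u C0) =
      (\<Sum>w\<in>W. scalar (\<Sum>i\<in>I. f i w) * point (act (u \<circ> w) C0))"
    using assms by (simp only: scalar_sum sum_distrib_right)
qed

text \<open>The set of faces of type \<open>J\<close> is stable under \<open>u\<close>, so
  \<open>u\<close> can be pulled out of every product. What remains is the projection of
  \<open>C0\<close> onto the faces of type \<open>J\<close>, and these projections are the chambers
  of the elements of \<open>X_set\<close>.\<close>

lemma represents_type_sum:
  assumes J: "J \<subseteq> \<Delta>"
  shows "represents (type_sum J) (x_elt \<Phi> \<Delta> J)"
  unfolding represents_def
proof
  fix u assume u: "u \<in> W"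
  have XW: "X_set \<Phi> \<Delta> J \<subseteq> W" by (auto simp: X_set_def)
  have bij: "bij_betw (act u) (faces_of_type J) (faces_of_type J)"
    using u W_inv[OF u] by (intro bij_betwI[of _ _ _ "act (inv u)"]) (auto simp: act_faces_of_type_iff)
  have "type_sum J * point (act u C0) = (\<Sum>F\<in>faces_of_type J. point (F + act u C0))"
    by (simp add: type_sum_def sum_distrib_right mult_single)
  also have "\<dots> = (\<Sum>F\<in>faces_of_type J. point (act u F + act u C0))"
    by (rule sum.reindex_bij_betw[OF bij, symmetric])
  also have "\<dots> = (\<Sum>w\<in>X_set \<Phi> \<Delta> J. point (act u (act w (std_face J)) + act u C0))"
    by (rule sum.reindex_bij_betw[OF X_set_std_bij[OF J], symmetric])
  also have "\<dots> = (\<Sum>w\<in>X_set \<Phi> \<Delta> J. point (act (u \<circ> w) C0))"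
  proof (intro sum.cong refl)
    fix w assume w: "w \<in> X_set \<Phi> \<Delta> J"
    then have "act u (act w (std_face J)) + act u C0 = act (u \<circ> w) C0"
      using X_set_std_add_C0[OF J w] u XW by (auto simp: act_add[symmetric] act_act)
    then show "point (act u (act w (std_face J)) + act u C0) = (point (act (u \<circ> w) C0) :: _ \<Rightarrow>\<^sub>0 real)"
      by simp
  qed
  also have "\<dots> = (\<Sum>w\<in>W. if w \<in> X_set \<Phi> \<Delta> J then point (act (u \<circ> w) C0) else 0)"
    using XW W_finite by (simp add: sum.inter_restrict[symmetric] Int_absorb1)
  also have "\<dots> = (\<Sum>w\<in>W. scalar (x_elt \<Phi> \<Delta> J w) * point (act (u \<circ> w) C0))"
    by (intro sum.cong refl) (simp add: x_elt_def)
  finally show "type_sum J * point (act u C0) =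
      (\<Sum>w\<in>W. scalar (x_elt \<Phi> \<Delta> J w) * point (act (u \<circ> w) C0))" .
qed

lemma chamber_sum_galg_mult:
  "chamber_sum (galg_mult W f g) =
    (\<Sum>u\<in>W. \<Sum>v\<in>W. scalar (f u * g v) * point (act (u \<circ> v) C0))"
proof -
  let ?h = "\<lambda>p. scalar (f (fst p) * g (snd p)) * (point (act (fst p \<circ> snd p) C0) :: _ \<Rightarrow>\<^sub>0 real)"
  have "(\<Sum>u\<in>W. \<Sum>v\<in>W. scalar (f u * g v) * point (act (u \<circ> v) C0)) = (\<Sum>p\<in>W \<times> W. ?h p)"
    by (simp only: sum.cartesian_product case_prod_unfold)
  also have "\<dots> = (\<Sum>w\<in>W. \<Sum>p\<in>{p \<in> W \<times> W. fst p \<circ> snd p = w}. ?h p)"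
    by (rule sum.group[symmetric]) (use W_finite W_comp in auto)
  also have "\<dots> = (\<Sum>w\<in>W. scalar (galg_mult W f g w) * point (act w C0))"
  proof (intro sum.cong refl)
    fix w
    have eq: "{p \<in> W \<times> W. fst p \<circ> snd p = w} = {(u, v) \<in> W \<times> W. u \<circ> v = w}" by auto
    have "finite {p \<in> W \<times> W. fst p \<circ> snd p = w}" using W_finite by auto
    then have "scalar (galg_mult W f g w) * point (act w C0) =
      (\<Sum>p\<in>{p \<in> W \<times> W. fst p \<circ> snd p = w}. scalar (f (fst p) * g (snd p)) * point (act w C0))"
      by (simp only: galg_mult_def eq[symmetric] case_prod_beta scalar_sum sum_distrib_right)
    also have "\<dots> = (\<Sum>p\<in>{p \<in> W \<times> W. fst p \<circ> snd p = w}. ?h p)"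
      by (intro sum.cong refl) auto
    finally show "(\<Sum>p\<in>{p \<in> W \<times> W. fst p \<circ> snd p = w}. ?h p) =
      scalar (galg_mult W f g w) * point (act w C0)" by simp
  qed
  finally show ?thesis by (simp add: chamber_sum_def)
qed

lemma represents_mult:
  assumes "represents A f" "represents B g"
  shows "A * B * point C0 = chamber_sum (galg_mult W g f)"
proof -
  have "B * point C0 = (\<Sum>u\<in>W. scalar (g u) * point (act u C0))"
    using assms(2) refl_group.one[of \<Phi>] unfolding represents_def by fastforce
  then have "A * B * point C0 = (\<Sum>u\<in>W. scalar (g u) * (A * point (act u C0)))"
    by (simp add: mult.assoc sum_distrib_left scalar_mult_left_commute[of A])
  also have "\<dots> = (\<Sum>u\<in>W. \<Sum>v\<in>W. scalar (g u * f v) * point (act (u \<circ> v) C0))"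
    using assms(1) by (intro sum.cong refl)
      (simp add: represents_def sum_distrib_left scalar_scalar del: comp_apply)
  finally show ?thesis by (simp only: chamber_sum_galg_mult)
qed

lemma represents_chamber_sum: "represents A f \<Longrightarrow> A * point C0 = chamber_sum f"
  using refl_group.one[of \<Phi>] unfolding represents_def chamber_sum_def by fastforce

lemma chamber_sum_inj:
  assumes "chamber_sum f = chamber_sum g" "w \<in> W"
  shows "f w = g w"
proof -
  have *: "Poly_Mapping.lookup (chamber_sum f) (act w C0) = f w" for f
  proof -
    have "Poly_Mapping.lookup (chamber_sum f) (act w C0) = (\<Sum>u\<in>W. if u = w then f u else 0)"
      unfolding chamber_sum_def lookup_sum using assms(2) act_C0_inj
      by (intro sum.cong refl) (auto simp: mult_single lookup_single when_def)
    then show ?thesis using assms(2) W_finite by simp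
  qed
  show ?thesis using *[of f] *[of g] assms by simp
qed

lemma M_elt_eq:
  "M_elt \<Phi> \<Delta> x w = (\<Sum>J\<in>Pow \<Delta>. 1 / (class_card J * x ^ card J) *
    (\<Sum>K\<in>Pow \<Delta>. beta \<Phi> \<Delta> J K * x_elt \<Phi> \<Delta> K w))"
proof -
  have "M_elt \<Phi> \<Delta> x w = (\<Sum>C\<in>classes \<Phi> \<Delta>.
      (\<Sum>J\<in>C. \<Sum>K\<in>Pow J. beta \<Phi> \<Delta> J K * x_elt \<Phi> \<Delta> K w) / (card C * x ^ class_rank C))"
    by (simp add: M_elt_def e_elt_def)
  also have "\<dots> = (\<Sum>J\<in>Pow \<Delta>.
      (\<Sum>K\<in>Pow J. beta \<Phi> \<Delta> J K * x_elt \<Phi> \<Delta> K w) / (class_card J * x ^ card J))"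
    by (rule sum_classes)
  also have "\<dots> = (\<Sum>J\<in>Pow \<Delta>.
      (\<Sum>K\<in>Pow \<Delta>. beta \<Phi> \<Delta> J K * x_elt \<Phi> \<Delta> K w) / (class_card J * x ^ card J))"
  proof (rule sum.cong[OF refl])
    fix J assume "J \<in> Pow \<Delta>"
    then have "(\<Sum>K\<in>Pow J. beta \<Phi> \<Delta> J K * x_elt \<Phi> \<Delta> K w) =
      (\<Sum>K\<in>Pow \<Delta>. beta \<Phi> \<Delta> J K * x_elt \<Phi> \<Delta> K w)"
      using beta_triangular by (intro sum.mono_neutral_left) auto
    then show "(\<Sum>K\<in>Pow J. beta \<Phi> \<Delta> J K * x_elt \<Phi> \<Delta> K w) / (class_card J * x ^ card J) =
      (\<Sum>K\<in>Pow \<Delta>. beta \<Phi> \<Delta> J K * x_elt \<Phi> \<Delta> K w) / (class_card J * x ^ card J)"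
      by simp
  qed
  finally show ?thesis by simp
qed

lemma represents_M_elt: "represents (diag (\<lambda>X. 1 / x ^ dim X)) (M_elt \<Phi> \<Delta> x)"
proof -
  have "represents (diag (\<lambda>X. 1 / x ^ dim X)) (\<lambda>w. \<Sum>J\<in>Pow \<Delta>. 1 / (class_card J * x ^ card J) *
    (\<Sum>K\<in>Pow \<Delta>. beta \<Phi> \<Delta> J K * x_elt \<Phi> \<Delta> K w))"
    unfolding diag_eq_sum_type_sum
    by (rule represents_sum, simp, rule represents_scalar, rule represents_sum, simp,
        rule represents_scalar, rule represents_type_sum) simp
  then show ?thesis by (simp add: M_elt_eq[abs_def])
qed

lemma M_elt_outside: "w \<notin> W \<Longrightarrow> M_elt \<Phi> \<Delta> x w = 0"
  by (simp add: M_elt_eq x_elt_def X_set_def)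

lemma galg_mult_outside:
  assumes "w \<notin> W"
  shows "galg_mult W f g w = 0"
proof -
  have "{(u, v) \<in> W \<times> W. u \<circ> v = w} = {}" using assms W_comp by auto
  then show ?thesis by (simp only: galg_mult_def) simp
qed

theorem M_elt_mult:
  "galg_mult W (M_elt \<Phi> \<Delta> x) (M_elt \<Phi> \<Delta> y) = M_elt \<Phi> \<Delta> (x * y)"
proof
  fix w
  have "chamber_sum (galg_mult W (M_elt \<Phi> \<Delta> x) (M_elt \<Phi> \<Delta> y)) =
      diag (\<lambda>X. 1 / y ^ dim X) * diag (\<lambda>X. 1 / x ^ dim X) * point C0"
    by (rule represents_mult[OF represents_M_elt represents_M_elt, symmetric])
  also have "\<dots> = diag (\<lambda>X. 1 / (x * y) ^ dim X) * point C0"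
    by (simp add: diag_mult power_mult_distrib mult.commute)
  also have "\<dots> = chamber_sum (M_elt \<Phi> \<Delta> (x * y))"
    by (rule represents_chamber_sum[OF represents_M_elt])
  finally show "galg_mult W (M_elt \<Phi> \<Delta> x) (M_elt \<Phi> \<Delta> y) w = M_elt \<Phi> \<Delta> (x * y) w"
    \<comment> \<open>\<open>chamber_sum\<close> sees only coefficients on the group; elsewhere both
      functions are 0.\<close>
    using chamber_sum_inj by (cases "w \<in> W") (blast, simp add: galg_mult_outside M_elt_outside)
qed

end

theorem mainTheorem2:
  fixes \<Phi> \<Delta> :: "'a::euclidean_space set" and x y :: real
  assumes "root_system \<Phi>" and "root_base \<Phi> \<Delta>"
    and "x \<noteq> 0" and "y \<noteq> 0"
  shows "galg_mult (refl_group \<Phi>) (M_elt \<Phi> \<Delta> x) (M_elt \<Phi> \<Delta> y) = M_elt \<Phi> \<Delta> (x * y)"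
proof -
  interpret based_root_system \<Phi> \<Delta>
    using assms by unfold_locales
  show ?thesis by (rule M_elt_mult)
qed

end
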